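(* Let $X$ be an irreducible sofic shift and $\pi: X\to Y$ a finite-to-one factor code. Let $\nu$ be a fully supported ergodic measure on $Y$. Then there exists an ergodic $d_\pi$-fold separating relative joining over $\nu$, where $d_\pi$ is the degree of $\pi$.
   Context: Shift spaces are two-sided with finite alphabet; "measure" means Borel probability measure, and "ergodic measure" means an ergodic shift-invariant measure. A factor code is a shift-commuting continuous surjection between shift spaces. For a finite-to-one factor code $\pi$ on an irreducible sofic shift, every doubly transitive point of $Y$ has the same finite number of preimages; this number is the degree $d_\pi$. An $n$-fold ($\pi$-)relative joining is a measure $\lambda$ on $X^n$, invariant under the product (diagonal) shift action, such that the set $X^n_\pi=\{(x^{(1)},\dots,x^{(n)})\in X^n:\pi(x^{(1)})=\dots=\pi(x^{(n)})\}$ has full $\lambda$-measure. With $p_i:X^n\to X$ the $i$-th coordinate projection, it is a relative joining over $\nu$ if $\pi p_i\lambda=\nu$ for some (hence every) $i$ (maps applied to measures mean pushforward). It is separating if for $\lambda$-a.e. $(x^{(1)},\dots,x^{(n)})$ the points $x^{(1)},\dots,x^{(n)}$ are $n$ distinct points. *)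

theory Defs
  imports "HOL-Probability.Probability"
begin

text \<open>
  An alphabet is a type of sort \<open>{finite, discrete_topology}\<close>; bi-infinite sequences
  \<open>int \<Rightarrow> 'a\<close> carry the product topology of the type class instance for functions.
\<close>

definition shift_map :: "(int \<Rightarrow> 'a) \<Rightarrow> int \<Rightarrow> 'a" where
  "shift_map x = (\<lambda>i. x (i + 1))"

definition shift_space :: "(int \<Rightarrow> 'a::{finite,discrete_topology}) set \<Rightarrow> bool" where
  "shift_space X \<longleftrightarrow> closed X \<and> shift_map ` X = X"

definition occurs_at :: "'a list \<Rightarrow> (int \<Rightarrow> 'a) \<Rightarrow> int \<Rightarrow> bool" where
  "occurs_at w x i \<longleftrightarrow> (\<forall>k<length w. x (i + int k) = w ! k)"

definition language :: "(int \<Rightarrow> 'a) set \<Rightarrow> 'a list set" where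
  "language X = {w. \<exists>x\<in>X. \<exists>i. occurs_at w x i}"

definition irreducible_shift :: "(int \<Rightarrow> 'a::{finite,discrete_topology}) set \<Rightarrow> bool" where
  "irreducible_shift X \<longleftrightarrow> shift_space X \<and>
     (\<forall>u\<in>language X. \<forall>v\<in>language X. \<exists>w. u @ w @ v \<in> language X)"

text \<open>
  \<open>E\<close> is the edge set of a finite labelled graph, an edge being (source, label, target).
  Parallel edges with equal labels, which a set of triples cannot represent, do not change
  the set of label sequences of bi-infinite walks; neither do isolated vertices.
\<close>

definition sofic_shift :: "(int \<Rightarrow> 'a::{finite,discrete_topology}) set \<Rightarrow> bool" where
  "sofic_shift X \<longleftrightarrow> shift_space X \<and>
     (\<exists>E :: (nat \<times> 'a \<times> nat) set. finite E \<and>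
        X = {x. \<exists>v :: int \<Rightarrow> nat. \<forall>i. (v i, x i, v (i + 1)) \<in> E})"

definition doubly_transitive :: "(int \<Rightarrow> 'a) set \<Rightarrow> (int \<Rightarrow> 'a) \<Rightarrow> bool" where
  "doubly_transitive X x \<longleftrightarrow> x \<in> X \<and>
     (\<forall>w\<in>language X. infinite {i. 0 \<le> i \<and> occurs_at w x i} \<and>
                      infinite {i. i \<le> 0 \<and> occurs_at w x i})"

definition factor_code ::
  "((int \<Rightarrow> 'a::{finite,discrete_topology}) \<Rightarrow> int \<Rightarrow> 'b::{finite,discrete_topology})
     \<Rightarrow> (int \<Rightarrow> 'a) set \<Rightarrow> (int \<Rightarrow> 'b) set \<Rightarrow> bool" where
  "factor_code \<pi> X Y \<longleftrightarrow> shift_space X \<and> shift_space Y \<and>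
     continuous_on X \<pi> \<and> \<pi> ` X = Y \<and> (\<forall>x\<in>X. \<pi> (shift_map x) = shift_map (\<pi> x))"

definition fibre ::
  "((int \<Rightarrow> 'a) \<Rightarrow> int \<Rightarrow> 'b) \<Rightarrow> (int \<Rightarrow> 'a) set \<Rightarrow> (int \<Rightarrow> 'b) \<Rightarrow> (int \<Rightarrow> 'a) set" where
  "fibre \<pi> X y = {x\<in>X. \<pi> x = y}"

definition finite_to_one ::
  "((int \<Rightarrow> 'a) \<Rightarrow> int \<Rightarrow> 'b) \<Rightarrow> (int \<Rightarrow> 'a) set \<Rightarrow> (int \<Rightarrow> 'b) set \<Rightarrow> bool" where
  "finite_to_one \<pi> X Y \<longleftrightarrow> (\<forall>y\<in>Y. finite (fibre \<pi> X y))"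

definition code_degree ::
  "((int \<Rightarrow> 'a) \<Rightarrow> int \<Rightarrow> 'b) \<Rightarrow> (int \<Rightarrow> 'a) set \<Rightarrow> (int \<Rightarrow> 'b) set \<Rightarrow> nat" where
  "code_degree \<pi> X Y =
     (THE d. \<forall>y. doubly_transitive Y y \<longrightarrow> finite (fibre \<pi> X y) \<and> card (fibre \<pi> X y) = d)"

definition borel_of :: "'a topology \<Rightarrow> 'a measure" where
  "borel_of T = sigma (topspace T) {U. openin T U}"

definition borel_prob :: "'a topology \<Rightarrow> 'a measure \<Rightarrow> bool" where
  "borel_prob T M \<longleftrightarrow> prob_space M \<and> sets M = sets (borel_of T)"

definition invariant_measure :: "('a \<Rightarrow> 'a) \<Rightarrow> 'a measure \<Rightarrow> bool" where
  "invariant_measure f M \<longleftrightarrow> f \<in> measurable M M \<and> distr M M f = M"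

definition ergodic_measure :: "('a \<Rightarrow> 'a) \<Rightarrow> 'a measure \<Rightarrow> bool" where
  "ergodic_measure f M \<longleftrightarrow> invariant_measure f M \<and>
     (\<forall>A\<in>sets M. f -` A \<inter> space M = A \<longrightarrow> emeasure M A = 0 \<or> emeasure M A = 1)"

definition fully_supported :: "'a topology \<Rightarrow> 'a measure \<Rightarrow> bool" where
  "fully_supported T M \<longleftrightarrow> (\<forall>U. openin T U \<and> U \<noteq> {} \<longrightarrow> emeasure M U > 0)"

text \<open>
  The space \<open>X\<^sup>n\<close> is the extensional product \<open>{..<n} \<rightarrow>\<^sub>E X\<close> with the product topology.
  Indices start at \<open>0\<close>.
\<close>

definition power_topology ::
  "nat \<Rightarrow> (int \<Rightarrow> 'a::{finite,discrete_topology}) set \<Rightarrow> (nat \<Rightarrow> int \<Rightarrow> 'a) topology" where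
  "power_topology n X = product_topology (\<lambda>_. top_of_set X) {..<n}"

definition diagonal_shift :: "nat \<Rightarrow> (nat \<Rightarrow> int \<Rightarrow> 'a) \<Rightarrow> nat \<Rightarrow> int \<Rightarrow> 'a" where
  "diagonal_shift n t = (\<lambda>i\<in>{..<n}. shift_map (t i))"

definition relative_power ::
  "((int \<Rightarrow> 'a) \<Rightarrow> int \<Rightarrow> 'b) \<Rightarrow> (int \<Rightarrow> 'a) set \<Rightarrow> nat \<Rightarrow> (nat \<Rightarrow> int \<Rightarrow> 'a) set" where
  "relative_power \<pi> X n = {t \<in> {..<n} \<rightarrow>\<^sub>E X. \<forall>i<n. \<forall>j<n. \<pi> (t i) = \<pi> (t j)}"

definition relative_joining ::
  "((int \<Rightarrow> 'a::{finite,discrete_topology}) \<Rightarrow> int \<Rightarrow> 'b) \<Rightarrow> (int \<Rightarrow> 'a) set \<Rightarrow> nat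
     \<Rightarrow> (nat \<Rightarrow> int \<Rightarrow> 'a) measure \<Rightarrow> bool" where
  "relative_joining \<pi> X n \<Lambda> \<longleftrightarrow>
     borel_prob (power_topology n X) \<Lambda> \<and>
     invariant_measure (diagonal_shift n) \<Lambda> \<and>
     (AE t in \<Lambda>. t \<in> relative_power \<pi> X n)"

definition relative_joining_over ::
  "((int \<Rightarrow> 'a::{finite,discrete_topology}) \<Rightarrow> int \<Rightarrow> 'b) \<Rightarrow> (int \<Rightarrow> 'a) set \<Rightarrow> nat
     \<Rightarrow> (int \<Rightarrow> 'b) measure \<Rightarrow> (nat \<Rightarrow> int \<Rightarrow> 'a) measure \<Rightarrow> bool" where
  "relative_joining_over \<pi> X n \<nu> \<Lambda> \<longleftrightarrow>
     relative_joining \<pi> X n \<Lambda> \<and> (\<exists>i<n. distr \<Lambda> \<nu> (\<lambda>t. \<pi> (t i)) = \<nu>)"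

definition separating :: "nat \<Rightarrow> (nat \<Rightarrow> int \<Rightarrow> 'a) measure \<Rightarrow> bool" where
  "separating n \<Lambda> \<longleftrightarrow> (AE t in \<Lambda>. inj_on t {..<n})"

end

theory Submission
  imports Defs
begin

text \<open>
The points of \<open>Y\<close> that matter are the doubly transitive ones. They form a set of full measure:
each of the countably many words of \<open>Y\<close> defines an invariant set of points in which it
recurs in one direction, of positive measure because the measure is invariant and fully supported,
hence of measure one by ergodicity (\<open>emeasure_doubly_transitive\<close>). Over each of them lie exactly
\<open>d\<close> points, where \<open>d\<close> is the degree (\<open>card_fibre_constant\<close>). So over almost every \<open>y\<close> there are
\<open>d!\<close> injective \<open>d\<close>-tuples of preimages, and the diagonal shift maps the tuples over \<open>y\<close>
bijectively onto those over the shift of \<open>y\<close>: the separated tuples form a finite extension of \<open>Y\<close>.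

An ergodic component of a finite extension can be found by counting. Integrate the counting measures
of the fibres against \<open>\<nu>\<close>. The number of tuples over \<open>y\<close> that lie in a given invariant set is an
invariant function of \<open>y\<close>, hence almost everywhere constant, so invariant sets have natural numbers
as measures. An invariant set of least positive measure cannot be split by another invariant set;
normalizing the measure on it gives an ergodic measure. Its image in \<open>Y\<close> is \<open>\<nu>\<close> because the
number of tuples in that set is almost everywhere constant
(\<open>finite_extension_ergodic_component\<close>). It lives on injective tuples, so it is separating.
Measurability of the construction rests on enumerating the fibres by \<open>d\<close> Borel functions
(\<open>measurable_enumeration_of_fibres\<close>).

That the number of preimages does not depend on the doubly transitive point is proved by covering
\<open>X\<close> by the space \<open>Z\<close> of bi-infinite walks on the graph of follower sets of synchronizing words. In
\<open>Z\<close>, unlike in \<open>X\<close>, two points can be glued wherever they show the same symbol, and \<open>Z\<close> is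
transitive. Choose a point of \<open>Y\<close> whose lifts to \<open>Z\<close> show the fewest blocks around the
origin. By compactness a finite word of this point already forces this minimal set of blocks; such a
word is called magic. If two lifts of a doubly transitive \<open>y\<close> agreed at a magic place and
differed later, this could be repeated far to the right, where the finitely many lifts of \<open>y\<close>
are already told apart by their pasts, a contradiction. Hence lifts of \<open>y\<close> are in bijection with the minimal set
of blocks (\<open>card_lifts\<close>). The same rigidity shows that every block of \<open>Z\<close> recurs in every
lift of \<open>y\<close> (\<open>blocks_recur_in_fibres\<close>), so preimages of \<open>y\<close> in \<open>X\<close> are again doubly
transitive. The count therefore applies to \<open>Z \<rightarrow> Y\<close> and to \<open>Z \<rightarrow> X\<close>, and
the quotient of the two numbers is the number of preimages of \<open>y\<close> in \<open>X\<close>.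
\<close>

section \<open>Limits and continuity in spaces of bi-infinite sequences\<close>

text \<open>
Compactness of the space of sequences over a finite alphabet, in the form used throughout. It is
proved by a diagonal choice so that it needs no topology on the alphabet; the states of the cover
below carry none.
\<close>

lemma finite_valued_sequences_have_limit:
  fixes f :: "nat \<Rightarrow> int \<Rightarrow> 'c"
  assumes V: "finite V" "\<And>n i. f n i \<in> V"
  shows "\<exists>g. \<forall>N. \<exists>n. N \<le> int n \<and> (\<forall>i. \<bar>i\<bar> \<le> N \<longrightarrow> f n i = g i)"
proof -
  \<comment> \<open>A decreasing chain of infinite index sets: on the \<open>k\<close>-th, the coordinates coded by numbers below \<open>k\<close> are constant.\<close>
  define P where "P A k B \<longleftrightarrow> infinite B \<and> B \<subseteq> A \<and>
      (\<exists>a. \<forall>n\<in>B. f n (int_decode k) = a)" for A B :: "nat set" and k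
  have step: "\<exists>B. P A k B" if "infinite A" for A k
  proof -
    have "finite ((\<lambda>n. f n (int_decode k)) ` A)"
      using V by (meson finite_subset image_subsetI)
    from pigeonhole_infinite[OF that this] obtain a where
      "a \<in> A" "infinite {n \<in> A. f n (int_decode k) = f a (int_decode k)}" by blast
    then show ?thesis unfolding P_def
      by (intro exI[of _ "{n \<in> A. f n (int_decode k) = f a (int_decode k)}"]) auto
  qed
  define A where "A = rec_nat (UNIV :: nat set) (\<lambda>k B. SOME C. P B k C)"
  have A0: "A 0 = UNIV" and AS: "\<And>k. A (Suc k) = (SOME C. P (A k) k C)"
    by (simp_all add: A_def)
  have inf: "infinite (A k)" for k
  proof (induction k)
    case (Suc k)
    then show ?case using someI_ex[OF step[OF Suc, of k]] AS P_def by metis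
  qed (simp add: A0)
  have PA: "P (A k) k (A (Suc k))" for k
    using someI_ex[OF step[OF inf[of k], of k]] AS by metis
  then obtain a where a: "\<And>k n. n \<in> A (Suc k) \<Longrightarrow> f n (int_decode k) = a k"
    unfolding P_def by metis
  have anti: "antimono A" using PA by (intro decseq_SucI) (auto simp: P_def)
  show ?thesis
  proof (intro exI[of _ "\<lambda>i. a (int_encode i)"] allI)
    fix N :: int
    define K where "K = Suc (Max (int_encode ` {-N..N} \<union> {0}))"
    have "\<exists>n\<in>A K. nat N \<le> n"
      using inf[of K] by (meson infinite_nat_iff_unbounded_le)
    then obtain n where n: "n \<in> A K" "N \<le> int n" by auto
    have "f n i = a (int_encode i)" if "\<bar>i\<bar> \<le> N" for i
    proof -
      have "int_encode i \<le> Max (int_encode ` {-N..N} \<union> {0})"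
        by (rule Max_ge) (use that in \<open>auto simp: abs_le_iff intro!: imageI\<close>)
      then have "Suc (int_encode i) \<le> K" unfolding K_def by simp
      then have "n \<in> A (Suc (int_encode i))" using n antimonoD[OF anti] by blast
      then show ?thesis using a[of n "int_encode i"] by simp
    qed
    then show "\<exists>n. N \<le> int n \<and> (\<forall>i. \<bar>i\<bar> \<le> N \<longrightarrow> f n i = a (int_encode i))"
      using n by blast
  qed
qed

text \<open>
Each pair of distinct functions differs at some coordinate, and there are finitely many pairs.
\<close>

lemma finite_functions_separated:
  fixes F :: "(int \<Rightarrow> 'c) set"
  assumes "finite F"
  shows "\<exists>T. \<forall>u\<in>F. \<forall>v\<in>F. (\<forall>l. \<bar>l\<bar> \<le> T \<longrightarrow> u l = v l) \<longrightarrow> u = v"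
proof -
  have "\<forall>u v. \<exists>l. u \<noteq> v \<longrightarrow> u l \<noteq> v l" for u v :: "int \<Rightarrow> 'c" by auto
  then obtain e where e: "\<And>u v :: int \<Rightarrow> 'c. u \<noteq> v \<Longrightarrow> u (e u v) \<noteq> v (e u v)" by metis
  have "\<bar>e u v\<bar> \<le> Max ((\<lambda>(u, v). \<bar>e u v\<bar>) ` (F \<times> F))" if "u \<in> F" "v \<in> F" for u v
    using assms that by (intro Max_ge) force+
  then show ?thesis using e by blast
qed

text \<open>
Cylinders form a base of the product topology; this translates between topological hypotheses and
statements about finite blocks.
\<close>

lemma open_contains_cylinder:
  fixes U :: "(int \<Rightarrow> 'a::topological_space) set"
  assumes "open U" "x \<in> U"
  shows "\<exists>N. \<forall>x'. (\<forall>i. \<bar>i\<bar> \<le> N \<longrightarrow> x' i = x i) \<longrightarrow> x' \<in> U"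
proof -
  have "openin (product_topology (\<lambda>i::int. euclidean :: 'a topology) UNIV) U"
    using assms(1) by (simp add: open_fun_def)
  then obtain W where W: "x \<in> PiE UNIV W" "finite {i. W i \<noteq> topspace (euclidean :: 'a topology)}"
      "PiE UNIV W \<subseteq> U"
    using product_topology_open_contains_basis[of "\<lambda>i::int. euclidean :: 'a topology" UNIV U x] assms(2)
    by blast
  let ?I = "{i. W i \<noteq> topspace (euclidean :: 'a topology)}"
  have "x' \<in> U" if "\<forall>i. \<bar>i\<bar> \<le> Max (abs ` ?I) \<longrightarrow> x' i = x i" for x'
  proof -
    have "x' i \<in> W i" for i
    proof (cases "i \<in> ?I")
      case True
      then have "\<bar>i\<bar> \<le> Max (abs ` ?I)" using W(2) by auto
      then show ?thesis using that W(1) by (auto simp: PiE_iff)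
    qed auto
    then show ?thesis using W(3) by (auto simp: PiE_iff)
  qed
  then show ?thesis by blast
qed

lemma closed_contains_limit:
  fixes X :: "(int \<Rightarrow> 'a::topological_space) set"
  assumes "closed X" and "\<And>N. \<exists>x'\<in>X. \<forall>i. \<bar>i\<bar> \<le> N \<longrightarrow> x' i = x i"
  shows "x \<in> X"
proof (rule ccontr)
  assume "x \<notin> X"
  then obtain N where "\<forall>x'. (\<forall>i. \<bar>i\<bar> \<le> N \<longrightarrow> x' i = x i) \<longrightarrow> x' \<in> - X"
    using open_contains_cylinder[of "- X" x] assms(1) by (auto simp: open_Compl)
  then show False using assms(2)[of N] by auto
qed

lemma open_coordinate: "open {x :: int \<Rightarrow> 'a::discrete_topology. x i \<in> A}"
proof -
  have "open ((\<lambda>x :: int \<Rightarrow> 'a. x i) -` A)"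
    using discrete_topology_class.open_discrete[of A] continuous_on_product_coordinates[of i] by (rule open_vimage)
  then show ?thesis by (simp add: vimage_def)
qed

lemma closed_coordinate: "closed {x :: int \<Rightarrow> 'a::discrete_topology. x i = a}"
proof -
  have "open {x :: int \<Rightarrow> 'a. x i \<in> - {a}}" by (rule open_coordinate)
  moreover have "{x :: int \<Rightarrow> 'a. x i \<in> - {a}} = - {x. x i = a}" by auto
  ultimately show ?thesis by (simp add: closed_def)
qed

lemma closedI_limits:
  fixes C :: "(int \<Rightarrow> 'a::discrete_topology) set"
  assumes "\<And>x. (\<And>N. \<exists>x'\<in>C. \<forall>i. \<bar>i\<bar> \<le> N \<longrightarrow> x' i = x i) \<Longrightarrow> x \<in> C"
  shows "closed C"
  unfolding closed_def
proof (subst open_subopen, intro ballI)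
  fix x assume "x \<in> - C"
  then obtain N where N: "\<And>x'. x' \<in> C \<Longrightarrow> \<not> (\<forall>i. \<bar>i\<bar> \<le> N \<longrightarrow> x' i = x i)" using assms by blast
  let ?U = "\<Inter>i\<in>{-N..N}. {x' :: int \<Rightarrow> 'a. x' i \<in> {x i}}"
  have "open ?U" by (intro open_INT ballI open_coordinate) simp
  moreover have "x \<in> ?U" by simp
  moreover have "?U \<subseteq> - C"
  proof
    fix x' assume "x' \<in> ?U"
    then have "\<forall>i. \<bar>i\<bar> \<le> N \<longrightarrow> x' i = x i" by (auto simp: abs_le_iff)
    then show "x' \<in> - C" using N by blast
  qed
  ultimately show "\<exists>T. open T \<and> x \<in> T \<and> T \<subseteq> - C" by blast
qed

lemma continuous_coordinate_local:
  fixes X :: "(int \<Rightarrow> 'a::topological_space) set"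
    and \<pi> :: "(int \<Rightarrow> 'a) \<Rightarrow> int \<Rightarrow> 'b::discrete_topology"
  assumes \<pi>: "continuous_on X \<pi>" and g: "g \<in> X"
  shows "\<exists>N. \<forall>x\<in>X. (\<forall>i. \<bar>i\<bar> \<le> N \<longrightarrow> x i = g i) \<longrightarrow> \<pi> x l = \<pi> g l"
proof -
  have "open {y :: int \<Rightarrow> 'b. y l \<in> {\<pi> g l}}" by (rule open_coordinate)
  then obtain U where U: "open U" "U \<inter> X = \<pi> -` {y. y l \<in> {\<pi> g l}} \<inter> X"
    using \<pi> unfolding continuous_on_open_invariant by metis
  have "g \<in> U" using U(2) g by auto
  then obtain N where N: "\<And>x'. (\<forall>i. \<bar>i\<bar> \<le> N \<longrightarrow> x' i = g i) \<Longrightarrow> x' \<in> U"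
    using open_contains_cylinder[OF U(1)] by blast
  then show ?thesis using U(2) by (intro exI[of _ N]) auto
qed

text \<open>
The essential part of the Curtis--Hedlund--Lyndon theorem: a continuous map reads only finitely many
coordinates. Otherwise there would be pairs of points agreeing on ever larger blocks around the
origin with different images, which a common limit point contradicts.
\<close>

lemma continuous_block_radius:
  fixes X :: "(int \<Rightarrow> 'a::{finite,discrete_topology}) set"
    and \<pi> :: "(int \<Rightarrow> 'a) \<Rightarrow> int \<Rightarrow> 'b::discrete_topology"
  assumes X: "closed X" and \<pi>: "continuous_on X \<pi>"
  shows "\<exists>r\<ge>0. \<forall>x\<in>X. \<forall>x'\<in>X. (\<forall>k. \<bar>k\<bar> \<le> r \<longrightarrow> x k = x' k) \<longrightarrow> \<pi> x 0 = \<pi> x' 0"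
proof (rule ccontr)
  assume "\<not> ?thesis"
  then have "\<exists>x\<in>X. \<exists>x'\<in>X. (\<forall>k. \<bar>k\<bar> \<le> int n \<longrightarrow> x k = x' k) \<and> \<pi> x 0 \<noteq> \<pi> x' 0" for n
    using of_nat_0_le_iff[of n] by blast
  then obtain f f' where f: "\<And>n. f n \<in> X" "\<And>n. f' n \<in> X"
     "\<And>n k. \<bar>k\<bar> \<le> int n \<Longrightarrow> f n k = f' n k" "\<And>n. \<pi> (f n) 0 \<noteq> \<pi> (f' n) 0" by metis
  obtain g where g: "\<And>N. \<exists>n. N \<le> int n \<and> (\<forall>i. \<bar>i\<bar> \<le> N \<longrightarrow> f n i = g i)"
    using finite_valued_sequences_have_limit[of "UNIV :: 'a set" f] by auto
  have "g \<in> X" using g f(1) by (intro closed_contains_limit[OF X]) blast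
  obtain N where N: "\<forall>x\<in>X. (\<forall>i. \<bar>i\<bar> \<le> N \<longrightarrow> x i = g i) \<longrightarrow> \<pi> x 0 = \<pi> g 0"
    using continuous_coordinate_local[OF \<pi> \<open>g \<in> X\<close>] by blast
  obtain n where n: "N \<le> int n" "\<forall>i. \<bar>i\<bar> \<le> N \<longrightarrow> f n i = g i" using g by blast
  have "\<forall>i. \<bar>i\<bar> \<le> N \<longrightarrow> f' n i = g i"
  proof (intro allI impI)
    fix i assume "\<bar>i\<bar> \<le> N"
    then show "f' n i = g i" using n f(3)[of i n] by simp
  qed
  then have "\<pi> (f n) 0 = \<pi> (f' n) 0" using N n(2) f(1)[of n] f(2)[of n] by simp
  then show False using f(4)[of n] by simp
qed

text \<open>
The image of a limit of preimages is the limit of the images. This makes sets of points that have a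
preimage in a prescribed closed set Borel, on which the measurability of fibre enumerations rests.
\<close>

lemma closed_continuous_image:
  fixes X :: "(int \<Rightarrow> 'a::{finite,discrete_topology}) set"
    and \<pi> :: "(int \<Rightarrow> 'a) \<Rightarrow> int \<Rightarrow> 'b::discrete_topology"
  assumes X: "closed X" and \<pi>: "continuous_on X \<pi>"
  shows "closed (\<pi> ` X)"
proof (rule closedI_limits)
  fix y assume y: "\<And>N. \<exists>y'\<in>\<pi> ` X. \<forall>i. \<bar>i\<bar> \<le> N \<longrightarrow> y' i = y i"
  then have "\<exists>x\<in>X. \<forall>i. \<bar>i\<bar> \<le> int n \<longrightarrow> \<pi> x i = y i" for n by (metis imageE)
  then obtain f where f: "\<And>n. f n \<in> X" "\<And>n i. \<bar>i\<bar> \<le> int n \<Longrightarrow> \<pi> (f n) i = y i" by metis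
  obtain g where g: "\<And>N. \<exists>n. N \<le> int n \<and> (\<forall>i. \<bar>i\<bar> \<le> N \<longrightarrow> f n i = g i)"
    using finite_valued_sequences_have_limit[of "UNIV :: 'a set" f] by auto
  have gX: "g \<in> X" using g f(1) by (intro closed_contains_limit[OF X]) blast
  have "\<pi> g l = y l" for l
  proof -
    obtain N where N: "\<forall>x\<in>X. (\<forall>i. \<bar>i\<bar> \<le> N \<longrightarrow> x i = g i) \<longrightarrow> \<pi> x l = \<pi> g l"
      using continuous_coordinate_local[OF \<pi> gX] by blast
    obtain n where n: "max N \<bar>l\<bar> \<le> int n" "\<forall>i. \<bar>i\<bar> \<le> max N \<bar>l\<bar> \<longrightarrow> f n i = g i"
      using g by blast
    have "\<pi> (f n) l = \<pi> g l" using N f(1)[of n] n(2) by simp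
    then show ?thesis using f(2)[of l n] n(1) by simp
  qed
  then show "y \<in> \<pi> ` X" using gX by (metis ext imageI)
qed

section \<open>Words, recurrence and translates\<close>

lemma occurs_at_map_upto:
  "occurs_at (map y' [a..b]) y (t + a) \<longleftrightarrow> (\<forall>i\<in>{a..b}. y (t + i) = y' i)"
proof -
  have "(\<forall>k<nat (b - a + 1). y (t + a + int k) = y' (a + int k)) \<longleftrightarrow> (\<forall>i\<in>{a..b}. y (t + i) = y' i)"
    (is "?L \<longleftrightarrow> ?R")
  proof
    assume L: ?L
    show ?R
    proof
      fix i assume "i \<in> {a..b}"
      then have "nat (i - a) < nat (b - a + 1)" "a + int (nat (i - a)) = i"
        "t + a + int (nat (i - a)) = t + i" by auto
      then show "y (t + i) = y' i" using L by metis
    qed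
  next
    assume R: ?R
    show ?L
    proof (intro allI impI)
      fix k assume "k < nat (b - a + 1)"
      then have "a + int k \<in> {a..b}" by auto
      then show "y (t + a + int k) = y' (a + int k)" using R by (metis add.assoc)
    qed
  qed
  then show ?thesis by (simp add: occurs_at_def)
qed

lemma map_upto_in_language: "y \<in> Y \<Longrightarrow> map y [a..b] \<in> language Y"
  using occurs_at_map_upto[of y a b y 0] by (auto simp: language_def)

lemma occurs_at_append:
  "occurs_at (u @ v) x i \<longleftrightarrow> occurs_at u x i \<and> occurs_at v x (i + int (length u))"
proof
  assume uv: "occurs_at (u @ v) x i"
  have "x (i + int (length u) + int k) = v ! k" if "k < length v" for k
    using uv[unfolded occurs_at_def, rule_format, of "length u + k"] that
    by (simp add: nth_append add.assoc)
  moreover have "x (i + int k) = u ! k" if "k < length u" for k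
    using uv[unfolded occurs_at_def, rule_format, of k] that by (simp add: nth_append)
  ultimately show "occurs_at u x i \<and> occurs_at v x (i + int (length u))"
    by (simp add: occurs_at_def)
next
  assume uv: "occurs_at u x i \<and> occurs_at v x (i + int (length u))"
  show "occurs_at (u @ v) x i"
    unfolding occurs_at_def
  proof (intro allI impI)
    fix k assume k: "k < length (u @ v)"
    show "x (i + int k) = (u @ v) ! k"
    proof (cases "k < length u")
      case False
      then have "k - length u < length v" using k by simp
      then have "x (i + int (length u) + int (k - length u)) = v ! (k - length u)"
        using uv unfolding occurs_at_def by blast
      moreover have "i + int (length u) + int (k - length u) = i + int k" using False by simp
      ultimately show ?thesis using False by (simp add: nth_append)
    qed (use uv in \<open>auto simp: occurs_at_def nth_append\<close>)
  qed
qed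

lemma language_appendD1: "u @ v \<in> language X \<Longrightarrow> u \<in> language X"
  unfolding language_def mem_Collect_eq occurs_at_append by blast

lemma language_appendD2: "u @ v \<in> language X \<Longrightarrow> v \<in> language X"
  unfolding language_def mem_Collect_eq occurs_at_append by blast

lemma occurs_at_shift_map: "occurs_at w (shift_map y) i \<longleftrightarrow> occurs_at w y (i + 1)"
  by (simp add: occurs_at_def shift_map_def ac_simps)

lemma infinite_int_nonneg_iff:
  "infinite {i::int. 0 \<le> i \<and> P i} \<longleftrightarrow> (\<forall>n::nat. \<exists>i. int n \<le> i \<and> P i)"
proof
  assume inf: "infinite {i::int. 0 \<le> i \<and> P i}"
  show "\<forall>n::nat. \<exists>i. int n \<le> i \<and> P i"
  proof (rule ccontr)
    assume "\<not> ?thesis"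
    then obtain n :: nat where "\<And>i. P i \<Longrightarrow> \<not> int n \<le> i" by blast
    then have "{i::int. 0 \<le> i \<and> P i} \<subseteq> {0..int n}" by fastforce
    then show False using inf finite_subset by blast
  qed
next
  assume R: "\<forall>n::nat. \<exists>i. int n \<le> i \<and> P i"
  show "infinite {i::int. 0 \<le> i \<and> P i}"
  proof
    assume fin: "finite {i::int. 0 \<le> i \<and> P i}"
    obtain i where i: "int (nat (Max (insert 0 {i::int. 0 \<le> i \<and> P i})) + 1) \<le> i" "P i" using R by blast
    have "0 \<le> Max (insert 0 {i::int. 0 \<le> i \<and> P i})" using fin by (intro Max_ge) auto
    then have "0 \<le> i" using i(1) by linarith
    then have "i \<le> Max (insert 0 {i::int. 0 \<le> i \<and> P i})" using fin i(2) by (intro Max_ge) auto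
    then show False using i(1) by linarith
  qed
qed

text \<open>
The sign \<open>\<epsilon> \<in> {1, -1}\<close> selects the direction of time, so that one proof covers both halves of double
transitivity.
\<close>

definition recurs :: "int \<Rightarrow> 'a list \<Rightarrow> (int \<Rightarrow> 'a) \<Rightarrow> bool" where
  "recurs \<epsilon> w y \<longleftrightarrow> (\<forall>n::nat. \<exists>i. int n \<le> \<epsilon> * i \<and> occurs_at w y i)"

lemma doubly_transitive_iff_recurs:
  "doubly_transitive Y y \<longleftrightarrow> y \<in> Y \<and> (\<forall>w\<in>language Y. recurs 1 w y \<and> recurs (- 1) w y)"
proof -
  have "infinite {i. i \<le> 0 \<and> occurs_at w y i} \<longleftrightarrow> recurs (- 1) w y" for w
  proof -
    have "{i. i \<le> 0 \<and> occurs_at w y i} = uminus ` {i. 0 \<le> i \<and> occurs_at w y (- i)}"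
      by (force intro: image_eqI[of _ uminus "- i" for i])
    then have "infinite {i. i \<le> 0 \<and> occurs_at w y i} \<longleftrightarrow> infinite {i. 0 \<le> i \<and> occurs_at w y (- i)}"
      by (simp add: finite_image_iff)
    also have "\<dots> \<longleftrightarrow> recurs (- 1) w y"
      unfolding infinite_int_nonneg_iff recurs_def by (metis minus_minus mult_minus1)
    finally show ?thesis .
  qed
  then show ?thesis by (simp add: doubly_transitive_def infinite_int_nonneg_iff recurs_def)
qed

lemma recurs_shift_map:
  assumes "\<bar>\<epsilon>\<bar> = 1"
  shows "recurs \<epsilon> w (shift_map y) \<longleftrightarrow> recurs \<epsilon> w y"
proof
  have e: "\<bar>\<epsilon> * (i + 1) - \<epsilon> * i\<bar> \<le> 1" for i using assms by (simp add: algebra_simps)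
  show "recurs \<epsilon> w y" if R: "recurs \<epsilon> w (shift_map y)"
    unfolding recurs_def
  proof
    fix n
    obtain i where "int (Suc n) \<le> \<epsilon> * i" "occurs_at w y (i + 1)"
      using R unfolding recurs_def occurs_at_shift_map by blast
    then show "\<exists>i. int n \<le> \<epsilon> * i \<and> occurs_at w y i"
      using e[of i] by (intro exI[of _ "i + 1"]) auto
  qed
  show "recurs \<epsilon> w (shift_map y)" if R: "recurs \<epsilon> w y"
    unfolding recurs_def occurs_at_shift_map
  proof
    fix n
    obtain i where "int (Suc n) \<le> \<epsilon> * i" "occurs_at w y i"
      using R unfolding recurs_def by blast
    then show "\<exists>i. int n \<le> \<epsilon> * i \<and> occurs_at w y (i + 1)"
      using e[of "i - 1"] by (intro exI[of _ "i - 1"]) auto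
  qed
qed

lemma doubly_transitive_shift_map:
  assumes "shift_space Y" "y \<in> Y"
  shows "doubly_transitive Y (shift_map y) \<longleftrightarrow> doubly_transitive Y y"
  using assms by (auto simp: doubly_transitive_iff_recurs recurs_shift_map shift_space_def)

lemma doubly_transitive_recurs:
  assumes "doubly_transitive Y y" "y' \<in> Y"
  shows "\<exists>t\<ge>K. \<forall>i\<in>{a..b}. y (t + i) = y' i"
    and "\<exists>t\<le>K. \<forall>i\<in>{a..b}. y (t + i) = y' i"
proof -
  let ?w = "map y' [a..b]"
  have rec: "recurs 1 ?w y" "recurs (- 1) ?w y"
    using assms map_upto_in_language[of y' Y a b] by (simp_all add: doubly_transitive_iff_recurs)
  obtain i where i: "int (nat (K + a)) \<le> 1 * i" "occurs_at ?w y i"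
    using rec(1) unfolding recurs_def by blast
  have "K \<le> i - a" using i(1) by linarith
  with i(2) show "\<exists>t\<ge>K. \<forall>i\<in>{a..b}. y (t + i) = y' i"
    using occurs_at_map_upto[of y' a b y "i - a"] by (intro exI[of _ "i - a"]) auto
  obtain i where i: "int (nat (- (K + a))) \<le> - 1 * i" "occurs_at ?w y i"
    using rec(2) unfolding recurs_def by blast
  have "i - a \<le> K" using i(1) by linarith
  with i(2) show "\<exists>t\<le>K. \<forall>i\<in>{a..b}. y (t + i) = y' i"
    using occurs_at_map_upto[of y' a b y "i - a"] by (intro exI[of _ "i - a"]) auto
qed

lemma doubly_transitiveI:
  assumes "y \<in> Y"
    and right: "\<And>y' a b K. y' \<in> Y \<Longrightarrow> \<exists>t\<ge>K. \<forall>i\<in>{a..b}. y (t + i) = y' i"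
    and left: "\<And>y' a b K. y' \<in> Y \<Longrightarrow> \<exists>t\<le>K. \<forall>i\<in>{a..b}. y (t + i) = y' i"
  shows "doubly_transitive Y y"
  unfolding doubly_transitive_iff_recurs
proof (intro conjI ballI assms(1))
  fix w assume "w \<in> language Y"
  then obtain y' i where y': "y' \<in> Y" "occurs_at w y' i" by (auto simp: language_def)
  have w: "occurs_at w y (t + i)" if "\<forall>j\<in>{i..i + int (length w)}. y (t + j) = y' j" for t
    using y'(2) that by (auto simp: occurs_at_def add.assoc)
  show "recurs 1 w y" unfolding recurs_def
  proof
    fix n
    obtain t where "t \<ge> int n - i" "\<forall>j\<in>{i..i + int (length w)}. y (t + j) = y' j"
      using right[OF y'(1)] by blast
    then show "\<exists>i. int n \<le> 1 * i \<and> occurs_at w y i" using w by (intro exI[of _ "t + i"]) simp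
  qed
  show "recurs (- 1) w y" unfolding recurs_def
  proof
    fix n
    obtain t where "t \<le> - int n - i" "\<forall>j\<in>{i..i + int (length w)}. y (t + j) = y' j"
      using left[OF y'(1)] by blast
    then show "\<exists>i. int n \<le> - 1 * i \<and> occurs_at w y i" using w by (intro exI[of _ "t + i"]) simp
  qed
qed

lemma shift_space_translate:
  assumes "shift_space X" "x \<in> X"
  shows "(\<lambda>i. x (i + k)) \<in> X"
proof (induction k rule: int_induct[where k = 0])
  case (step1 k)
  have "shift_map (\<lambda>i. x (i + k)) \<in> X" using assms(1) step1 by (auto simp: shift_space_def)
  then show ?case by (simp add: shift_map_def ac_simps)
next
  case (step2 k)
  then obtain x' where x': "x' \<in> X" "(\<lambda>i. x (i + k)) = shift_map x'"
    using assms(1) by (auto simp: shift_space_def)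
  have "x' i = x (i + (k - 1))" for i
    using fun_cong[OF x'(2), of "i - 1"] by (simp add: shift_map_def algebra_simps)
  then show ?case using x'(1) by (metis (no_types, lifting) ext)
qed (use assms in simp)

lemma factor_code_translate:
  assumes "factor_code \<pi> X Y" "x \<in> X"
  shows "\<pi> (\<lambda>i. x (i + k)) = (\<lambda>i. \<pi> x (i + k))"
proof -
  have X: "shift_space X" and comm: "\<And>x. x \<in> X \<Longrightarrow> \<pi> (shift_map x) = shift_map (\<pi> x)"
    using assms by (auto simp: factor_code_def)
  show ?thesis
  proof (induction k rule: int_induct[where k = 0])
    case (step1 k)
    have "\<pi> (shift_map (\<lambda>i. x (i + k))) = shift_map (\<lambda>i. \<pi> x (i + k))"
      using comm[OF shift_space_translate[OF X assms(2)], of k] step1 by simp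
    then show ?case by (simp add: shift_map_def ac_simps)
  next
    case (step2 k)
    have "\<pi> (shift_map (\<lambda>i. x (i + (k - 1)))) = shift_map (\<pi> (\<lambda>i. x (i + (k - 1))))"
      by (rule comm[OF shift_space_translate[OF X assms(2)]])
    then have *: "shift_map (\<pi> (\<lambda>i. x (i + (k - 1)))) = (\<lambda>i. \<pi> x (i + k))"
      using step2 by (simp add: shift_map_def ac_simps)
    show ?case
    proof
      fix i show "\<pi> (\<lambda>i. x (i + (k - 1))) i = \<pi> x (i + (k - 1))"
        using fun_cong[OF *, of "i - 1"] by (simp add: shift_map_def algebra_simps)
    qed
  qed simp
qed

lemma language_occurs_at:
  assumes "shift_space X" "w \<in> language X"
  shows "\<exists>x\<in>X. occurs_at w x k"
proof -
  obtain x i where "x \<in> X" "occurs_at w x i" using assms(2) by (auto simp: language_def)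
  then show ?thesis
    using shift_space_translate[OF assms(1), of x "i - k"]
    by (intro bexI[of _ "\<lambda>j. x (j + (i - k))"]) (auto simp: occurs_at_def algebra_simps)
qed

section \<open>Fibres of a code on a space closed under gluing\<close>

text \<open>
A code \<open>\<Phi>\<close> with finite fibres and radius \<open>r\<close> on a one-step Markov space \<open>Z\<close>: a closed
shift-invariant space in which points with a common symbol at \<open>i\<close> can be glued there. Closedness
is expressed by agreement on finite blocks since the alphabet has no topology.
\<close>

locale markov_code =
  fixes Z :: "(int \<Rightarrow> 'c) set" and V :: "'c set" and \<Phi> :: "(int \<Rightarrow> 'c) \<Rightarrow> int \<Rightarrow> 'b" and r :: int
  assumes finite_V: "finite V"
    and Z_V: "z \<in> Z \<Longrightarrow> z i \<in> V"
    and Z_closed: "(\<And>N. \<exists>z'\<in>Z. \<forall>i. \<bar>i\<bar> \<le> N \<longrightarrow> z' i = z i) \<Longrightarrow> z \<in> Z"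
    and Z_shift: "z \<in> Z \<Longrightarrow> (\<lambda>i. z (i + k)) \<in> Z"
    and Z_glue: "z \<in> Z \<Longrightarrow> z' \<in> Z \<Longrightarrow> z i = z' i \<Longrightarrow> (\<lambda>l. if l \<le> i then z l else z' l) \<in> Z"
    and r_nonneg: "0 \<le> r"
    and \<Phi>_local: "z \<in> Z \<Longrightarrow> z' \<in> Z \<Longrightarrow> (\<And>k. \<bar>k\<bar> \<le> r \<Longrightarrow> z (i + k) = z' (i + k)) \<Longrightarrow> \<Phi> z i = \<Phi> z' i"
    and \<Phi>_shift: "z \<in> Z \<Longrightarrow> \<Phi> (\<lambda>i. z (i + k)) = (\<lambda>i. \<Phi> z (i + k))"
    and \<Phi>_finite: "finite {z \<in> Z. \<Phi> z = y}"

begin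

definition lifts :: "(int \<Rightarrow> 'b) \<Rightarrow> (int \<Rightarrow> 'c) set" where
  "lifts y = {z \<in> Z. \<Phi> z = y}"

definition local_block :: "(int \<Rightarrow> 'c) \<Rightarrow> int \<Rightarrow> 'c list" where
  "local_block z i = map (\<lambda>k. z (i + k)) [-r..r]"

lemma local_block_eq_iff: "local_block z i = local_block z' j \<longleftrightarrow> (\<forall>k. \<bar>k\<bar> \<le> r \<longrightarrow> z (i + k) = z' (j + k))"
  unfolding local_block_def by (auto simp: abs_le_iff)

lemma local_block_shift: "local_block (\<lambda>i. z (i + k)) j = local_block z (j + k)"
  by (simp add: local_block_def ac_simps)

lemma finite_lifts: "finite (lifts y)"
  using \<Phi>_finite by (simp add: lifts_def)

lemma lifts_shift: "z \<in> lifts y \<Longrightarrow> (\<lambda>i. z (i + k)) \<in> lifts (\<lambda>i. y (i + k))"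
  using Z_shift \<Phi>_shift by (auto simp: lifts_def)

lemma lifts_shift_iff: "(\<lambda>i. z (i + k)) \<in> lifts (\<lambda>i. y (i + k)) \<longleftrightarrow> z \<in> lifts y"
  using lifts_shift[of z y k] lifts_shift[of "\<lambda>i. z (i + k)" "\<lambda>i. y (i + k)" "-k"] by auto

lemma image_shift: "y \<in> \<Phi> ` Z \<Longrightarrow> (\<lambda>i. y (i + k)) \<in> \<Phi> ` Z"
  by (auto simp flip: \<Phi>_shift intro!: imageI Z_shift)

text \<open>
Agreement on a whole radius around \<open>i\<close> makes gluing compatible with the code: each window read by
\<open>\<Phi>\<close> then lies inside the part where the glued point follows only one of the two.
\<close>

lemma glue_image:
  assumes z: "z \<in> Z" "z' \<in> Z" and w: "local_block z i = local_block z' i"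
  defines "g \<equiv> (\<lambda>l. if l \<le> i then z l else z' l)"
  shows "g \<in> Z" "\<Phi> g l = (if l \<le> i then \<Phi> z l else \<Phi> z' l)"
proof -
  have eq: "z (i + k) = z' (i + k)" if "\<bar>k\<bar> \<le> r" for k using w that by (simp add: local_block_eq_iff)
  show g: "g \<in> Z" unfolding g_def
    using Z_glue[OF z, of i] eq[of 0] r_nonneg by simp
  have a: "g l = z l" if "l \<le> i + r" for l using eq[of "l - i"] that by (auto simp: g_def)
  have b: "g l = z' l" if "l \<ge> i - r" for l using eq[of "l - i"] that by (auto simp: g_def)
  show "\<Phi> g l = (if l \<le> i then \<Phi> z l else \<Phi> z' l)"
    using \<Phi>_local[OF g z(1), of l] \<Phi>_local[OF g z(2), of l] a b by auto
qed

text \<open>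
Gluing twice replaces the middle of a point by a segment of \<open>z\<close> without changing the image \<open>y\<close>.
\<close>

lemma sandwich:
  assumes y: "a \<in> lifts y" "b \<in> lifts y" and z: "z \<in> Z" and ij: "i \<le> j"
    and wi: "local_block a i = local_block z i" and wj: "local_block b j = local_block z j"
    and eq: "\<And>l. i \<le> l \<Longrightarrow> l \<le> j \<Longrightarrow> \<Phi> z l = y l"
  shows "(\<lambda>l. if l \<le> i then a l else if l \<le> j then z l else b l) \<in> lifts y"
proof -
  let ?h = "\<lambda>l. if l \<le> j then z l else b l"
  have Z: "a \<in> Z" "b \<in> Z" "\<Phi> a = y" "\<Phi> b = y" using y by (auto simp: lifts_def)
  note h = glue_image[OF z Z(2), of j, OF wj[symmetric]]
  have "local_block a i = local_block ?h i"
  proof -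
    have "?h (i + k) = z (i + k)" if "\<bar>k\<bar> \<le> r" for k
      using wj that ij by (auto simp: local_block_eq_iff dest: spec[of _ "i + k - j"])
    then show ?thesis using wi by (auto simp: local_block_eq_iff)
  qed
  note g = glue_image[OF Z(1) h(1) this]
  have "\<Phi> (\<lambda>l. if l \<le> i then a l else ?h l) = y"
    using g(2) h(2) Z eq by (auto simp: fun_eq_iff)
  then show ?thesis using g(1) by (simp add: lifts_def)
qed

definition sees :: "(int \<Rightarrow> 'b) \<Rightarrow> int \<Rightarrow> (int \<Rightarrow> 'b) \<Rightarrow> int \<Rightarrow> bool" where
  "sees y0 N y i \<longleftrightarrow> (\<forall>l. \<bar>l\<bar> \<le> N \<longrightarrow> y (i + l) = y0 l)"

lemma sees_transfer:
  assumes "sees y0 N y' i" "\<forall>l\<in>{a..b}. y (t + l) = y' l" "a \<le> i - N" "i + N \<le> b"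
  shows "sees y0 N y (t + i)"
  unfolding sees_def
proof (intro allI impI)
  fix l assume l: "\<bar>l\<bar> \<le> N"
  then have "i + l \<in> {a..b}" using assms(3,4) by auto
  then have "y (t + (i + l)) = y' (i + l)" using assms(2) by blast
  then show "y (t + i + l) = y0 l" using assms(1) l by (simp add: sees_def add.assoc)
qed

text \<open>
An analogue for blocks of lifts of the magic words of Lind and Marcus: the word of \<open>y0\<close> on \<open>[-N, N]\<close>
alone determines which blocks the lifts show there.
\<close>

definition magic :: "(int \<Rightarrow> 'b) \<Rightarrow> int \<Rightarrow> 'c list set \<Rightarrow> bool" where
  "magic y0 N W \<longleftrightarrow> y0 \<in> \<Phi> ` Z \<and> 0 \<le> N \<and> finite W \<and>
     (\<forall>y\<in>\<Phi> ` Z. \<forall>i. sees y0 N y i \<longrightarrow> (\<lambda>z. local_block z i) ` lifts y = W)"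

text \<open>
Take \<open>y0\<close> to minimize the number of blocks of its lifts at the origin. By compactness a point that agrees with
\<open>y0\<close> far enough has no further blocks, and by minimality it cannot have fewer.
\<close>

lemma magic_exists:
  assumes "Z \<noteq> {}" shows "\<exists>y0 N W. magic y0 N W"
proof -
  define P where "P y = (\<lambda>z. local_block z 0) ` lifts y" for y
  obtain z0 where "z0 \<in> Z" using assms by blast
  from ex_has_least_nat[of "\<lambda>y. y \<in> \<Phi> ` Z", OF imageI[OF this], of "\<lambda>y. card (P y)"]
  obtain y0 where y0: "y0 \<in> \<Phi> ` Z" and min: "\<And>y. y \<in> \<Phi> ` Z \<Longrightarrow> card (P y0) \<le> card (P y)"
    by blast
  have finP: "finite (P y)" for y by (simp add: P_def finite_lifts)
  have "\<exists>N\<ge>0. \<forall>y\<in>\<Phi> ` Z. (\<forall>l. \<bar>l\<bar> \<le> N \<longrightarrow> y l = y0 l) \<longrightarrow> P y \<subseteq> P y0"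
  proof (rule ccontr)
    assume neg: "\<not> ?thesis"
    have "\<exists>z\<in>Z. (\<forall>l. \<bar>l\<bar> \<le> int n \<longrightarrow> \<Phi> z l = y0 l) \<and> local_block z 0 \<notin> P y0" for n
    proof -
      obtain y where y: "\<forall>l. \<bar>l\<bar> \<le> int n \<longrightarrow> y l = y0 l" "\<not> P y \<subseteq> P y0"
        using neg of_nat_0_le_iff[of n] by blast
      obtain p where p: "p \<in> P y" "p \<notin> P y0" using y(2) by blast
      obtain z where z: "z \<in> lifts y" "p = local_block z 0" using p(1) unfolding P_def by (rule imageE)
      have "z \<in> Z" "\<Phi> z = y" using z(1) by (auto simp: lifts_def)
      then show ?thesis using y(1) p(2) z(2) by (intro bexI[of _ z]) auto
    qed
    then obtain f where f: "\<And>n. f n \<in> Z" "\<And>n l. \<bar>l\<bar> \<le> int n \<Longrightarrow> \<Phi> (f n) l = y0 l"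
       "\<And>n. local_block (f n) 0 \<notin> P y0" by metis
    obtain g where g: "\<And>N. \<exists>n. N \<le> int n \<and> (\<forall>i. \<bar>i\<bar> \<le> N \<longrightarrow> f n i = g i)"
      using finite_valued_sequences_have_limit[OF finite_V, of f] Z_V f(1) by blast
    have gZ: "g \<in> Z"
    proof (rule Z_closed)
      fix N
      obtain n where "\<forall>i. \<bar>i\<bar> \<le> N \<longrightarrow> f n i = g i" using g[of N] by auto
      then show "\<exists>z'\<in>Z. \<forall>i. \<bar>i\<bar> \<le> N \<longrightarrow> z' i = g i" using f(1) by blast
    qed
    have "\<Phi> g l = y0 l" for l
    proof -
      obtain n where n: "\<bar>l\<bar> + r \<le> int n" "\<And>i. \<bar>i\<bar> \<le> \<bar>l\<bar> + r \<Longrightarrow> f n i = g i"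
        using g[of "\<bar>l\<bar> + r"] by auto
      have "\<Phi> (f n) l = \<Phi> g l" by (rule \<Phi>_local[OF f(1) gZ]) (auto intro!: n(2))
      then show ?thesis using f(2)[of l n] n(1) r_nonneg by simp
    qed
    then have "g \<in> lifts y0" using gZ by (auto simp: lifts_def)
    then have "local_block g 0 \<in> P y0" by (simp add: P_def)
    moreover obtain n where "\<forall>i. \<bar>i\<bar> \<le> r \<longrightarrow> f n i = g i" using g[of r] by auto
    then have "local_block (f n) 0 = local_block g 0" by (simp add: local_block_eq_iff)
    ultimately show False using f(3)[of n] by simp
  qed
  then obtain N where N: "N \<ge> 0"
    "\<And>y. y \<in> \<Phi> ` Z \<Longrightarrow> (\<And>l. \<bar>l\<bar> \<le> N \<Longrightarrow> y l = y0 l) \<Longrightarrow> P y \<subseteq> P y0" by metis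
  have "(\<lambda>z. local_block z i) ` lifts y = P y0" if "y \<in> \<Phi> ` Z" "sees y0 N y i" for y i
  proof -
    let ?y = "\<lambda>l. y (l + i)"
    have "?y \<in> \<Phi> ` Z" using image_shift that by blast
    moreover from this have "P ?y \<subseteq> P y0"
      using that(2) by (intro N) (auto simp: sees_def add.commute)
    ultimately have "P ?y = P y0" using min[of ?y] by (intro card_seteq finP) auto
    \<comment> \<open>Both sides agree since translating by \<open>i\<close> maps the lifts of \<open>y\<close> onto those of \<open>?y\<close>.\<close>
    moreover have "P ?y = (\<lambda>z. local_block z i) ` lifts y"
    proof -
      have "lifts ?y = (\<lambda>z l. z (l + i)) ` lifts y"
      proof (intro equalityI subsetI)
        fix z assume "z \<in> lifts ?y"
        then have "(\<lambda>l. z (l - i)) \<in> lifts y" using lifts_shift_iff[of "\<lambda>l. z (l - i)" i y] by simp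
        then show "z \<in> (\<lambda>z l. z (l + i)) ` lifts y" by (rule rev_image_eqI) simp
      qed (auto intro: lifts_shift)
      then show ?thesis by (simp add: P_def image_image local_block_shift)
    qed
    ultimately show ?thesis by simp
  qed
  then have "magic y0 N (P y0)" unfolding magic_def using y0 N(1) finP by auto
  then show ?thesis by (intro exI)
qed

lemma magic_blocks:
  "magic y0 N W \<Longrightarrow> y \<in> \<Phi> ` Z \<Longrightarrow> sees y0 N y i \<Longrightarrow> (\<lambda>z. local_block z i) ` lifts y = W"
  unfolding magic_def by blast

lemma doubly_transitive_sees:
  assumes "magic y0 N W" "doubly_transitive (\<Phi> ` Z) y"
  shows "\<exists>i\<ge>K. sees y0 N y i" "\<exists>i\<le>K. sees y0 N y i"
  using doubly_transitive_recurs[OF assms(2), of y0 _ "-N" N] assms(1)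
  by (fastforce simp: sees_def magic_def)+

lemma magic_lift:
  assumes "magic y0 N W" "y \<in> \<Phi> ` Z" "sees y0 N y i" "p \<in> W"
  obtains z where "z \<in> lifts y" "local_block z i = p"
  using magic_blocks[OF assms(1-3)] assms(4) by (metis imageE)

lemma magic_block:
  assumes "magic y0 N W" "sees y0 N y i" "z \<in> lifts y"
  shows "local_block z i \<in> W"
proof -
  have "y \<in> \<Phi> ` Z" using assms(3) by (auto simp: lifts_def)
  then have "(\<lambda>z. local_block z i) ` lifts y = W" using magic_blocks assms(1,2) by blast
  then show ?thesis using assms(3) by blast
qed

text \<open>
Since the fibre is finite, its points are told apart by their restrictions to some left half-line.
The word of \<open>y\<close> between \<open>i\<close> and a later magic place recurs beyond that half-line. There, both
\<open>z\<close> and \<open>z'\<close> can be spliced into the same lift of \<open>y\<close>; the two results have the same left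
half-line, so they coincide, and with them \<open>z\<close> and \<open>z'\<close>.
\<close>

lemma future_determined:
  assumes m: "magic y0 N W" and dt: "doubly_transitive (\<Phi> ` Z) y" and i: "sees y0 N y i"
    and z: "z \<in> lifts y" "z' \<in> lifts y" "local_block z i = local_block z' i" and c: "i \<le> c"
  shows "z c = z' c"
proof -
  have y: "y \<in> \<Phi> ` Z" using dt by (simp add: doubly_transitive_def)
  have N: "0 \<le> N" using m by (simp add: magic_def)
  obtain j where j: "c \<le> j" "sees y0 N y j" using doubly_transitive_sees[OF m dt] by blast
  obtain T where "\<forall>u\<in>lifts y. \<forall>v\<in>lifts y. (\<forall>l. \<bar>l\<bar> \<le> T \<longrightarrow> u l = v l) \<longrightarrow> u = v"
    using finite_functions_separated[OF finite_lifts] by blast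
  then obtain T where T: "\<And>u v. u \<in> lifts y \<Longrightarrow> v \<in> lifts y \<Longrightarrow> (\<And>l. l \<le> T \<Longrightarrow> u l = v l) \<Longrightarrow> u = v"
    by (meson abs_le_D1)
  obtain k where k: "k \<ge> T - i" "\<forall>l\<in>{i - N..j + N}. y (k + l) = y l"
    using doubly_transitive_recurs(1)[OF dt y] by blast
  have si: "sees y0 N y (k + i)"
    by (rule sees_transfer[OF i k(2)]) (use j(1) c in auto)
  have sj: "sees y0 N y (k + j)"
    by (rule sees_transfer[OF j(2) k(2)]) (use j(1) c in auto)
  obtain a where a: "a \<in> lifts y" "local_block a (k + i) = local_block z i"
    using magic_lift[OF m y si] magic_block[OF m i z(1)] by blast
  \<comment> \<open>The lift \<open>a\<close> is followed up to the recurrence, then \<open>u\<close> is inserted; magic at both ends provides lifts to glue to.\<close>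
  have ex: "\<exists>g\<in>lifts y. (\<forall>l\<le>k + i. g l = a l) \<and> (\<forall>l. i < l \<and> l \<le> j \<longrightarrow> g (k + l) = u l)"
    if u: "u \<in> lifts y" "local_block u i = local_block z i" for u
  proof -
    obtain b where b: "b \<in> lifts y" "local_block b (k + j) = local_block u j"
      using magic_lift[OF m y sj] magic_block[OF m j(2) u(1)] by blast
    let ?u = "\<lambda>l. u (l + (-k))"
    have uZ: "u \<in> Z" "\<Phi> u = y" using u by (auto simp: lifts_def)
    have "(\<lambda>l. if l \<le> k + i then a l else if l \<le> k + j then ?u l else b l) \<in> lifts y"
    proof (rule sandwich[OF a(1) b(1) Z_shift[OF uZ(1)]])
      show "local_block a (k + i) = local_block ?u (k + i)" using a u by (subst local_block_shift) simp
      show "local_block b (k + j) = local_block ?u (k + j)" using b by (subst local_block_shift) simp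
      fix l assume "k + i \<le> l" "l \<le> k + j"
      then show "\<Phi> ?u l = y l" using \<Phi>_shift[OF uZ(1), of "-k"] uZ(2) k(2) N
        by (auto dest: bspec[of _ _ "l - k"])
    qed (use j c in auto)
    then show ?thesis by (rule bexI[rotated]) auto
  qed
  obtain g where g: "g \<in> lifts y" "\<forall>l\<le>k + i. g l = a l" "\<forall>l. i < l \<and> l \<le> j \<longrightarrow> g (k + l) = z l"
    using ex[OF z(1)] by blast
  obtain g' where g': "g' \<in> lifts y" "\<forall>l\<le>k + i. g' l = a l" "\<forall>l. i < l \<and> l \<le> j \<longrightarrow> g' (k + l) = z' l"
    using ex[OF z(2)] z(3) by metis
  have "g = g'" using T[OF g(1) g'(1)] g(2) g'(2) k(1) by force
  moreover have "z i = z' i" using z(3) r_nonneg by (auto simp: local_block_eq_iff dest: spec[of _ 0])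
  ultimately show ?thesis using g(3) g'(3) c j(1) by (cases "c = i") auto
qed

text \<open>
Distinct lifts differ at a coordinate bounded by some \<open>T\<close>. At a magic place to the left of \<open>-T\<close>
they show different blocks, because equal blocks would force equal futures, and they show all the blocks in \<open>W\<close>.
\<close>

lemma card_lifts:
  assumes m: "magic y0 N W" and dt: "doubly_transitive (\<Phi> ` Z) y"
  shows "card (lifts y) = card W"
proof -
  have y: "y \<in> \<Phi> ` Z" using dt by (simp add: doubly_transitive_def)
  obtain T where T: "\<forall>u\<in>lifts y. \<forall>v\<in>lifts y. (\<forall>l. \<bar>l\<bar> \<le> T \<longrightarrow> u l = v l) \<longrightarrow> u = v"
    using finite_functions_separated[OF finite_lifts] by blast
  obtain i where i: "i \<le> -T" "sees y0 N y i" using doubly_transitive_sees[OF m dt] by blast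
  have "inj_on (\<lambda>z. local_block z i) (lifts y)"
    proof (rule inj_onI)
    fix u v assume uv: "u \<in> lifts y" "v \<in> lifts y" "local_block u i = local_block v i"
    have "u l = v l" if "\<bar>l\<bar> \<le> T" for l
      using future_determined[OF m dt i(2) uv, of l] i(1) that by auto
    then show "u = v" using T uv by blast
  qed
  moreover have "(\<lambda>z. local_block z i) ` lifts y = W" by (rule magic_blocks[OF m y i(2)])
  ultimately show ?thesis by (metis card_image)
qed

lemma card_lifts_constant:
  "\<exists>d. \<forall>y. doubly_transitive (\<Phi> ` Z) y \<longrightarrow> card (lifts y) = d"
proof (cases "Z = {}")
  case True then show ?thesis by (simp add: doubly_transitive_def)
next
  case False
  then show ?thesis using magic_exists card_lifts by meson
qed

text \<open>
For each block \<open>p\<close> in \<open>W\<close> a word of the image can be found that starts with the magic word and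
forces every lift that starts with \<open>p\<close> to show the block of \<open>z1\<close>. Such words are built for more
and more blocks of \<open>W\<close>: take a point above the word found so far that starts with the next block, change
its future by transitivity so that it shows the block of \<open>z1\<close> and then the magic word
again, and use the image of the result. That a lift of a doubly transitive point must follow this path is the
uniqueness of the future. The word obtained for all of \<open>W\<close> recurs in \<open>y\<close>.
\<close>

lemma blocks_recur_in_fibres:
  assumes trans: "\<And>z z1 T K. z \<in> Z \<Longrightarrow> z1 \<in> Z \<Longrightarrow>
      \<exists>z'\<in>Z. (\<forall>i\<le>T. z' i = z i) \<and> (\<exists>t>T + K. \<forall>i\<ge>-K. z' (t + i) = z1 i)"
    and dt: "doubly_transitive (\<Phi> ` Z) y" and z: "z \<in> lifts y" and z1: "z1 \<in> Z"
  shows "\<exists>t\<ge>K. \<forall>i\<in>{a..b}. z (t + i) = z1 i" "\<exists>t\<le>K. \<forall>i\<in>{a..b}. z (t + i) = z1 i"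
proof -
  obtain y0 N W where m: "magic y0 N W" using magic_exists z by (auto simp: lifts_def)
  have N: "0 \<le> N" and finW: "finite W" using m by (auto simp: magic_def)
  have y0: "y0 \<in> \<Phi> ` Z" using m by (simp add: magic_def)
  then obtain z0 where z0: "z0 \<in> Z" "\<Phi> z0 = y0" by auto
  have "\<exists>y1\<in>\<Phi> ` Z. \<exists>L\<ge>N. sees y0 N y1 0 \<and>
          (\<forall>y t z. doubly_transitive (\<Phi> ` Z) y \<longrightarrow> (\<forall>i\<in>{-N..L}. y (t + i) = y1 i) \<longrightarrow>
             z \<in> lifts y \<longrightarrow> local_block z t \<in> Q \<longrightarrow>
             (\<exists>s. t \<le> s + a \<and> s + b \<le> t + L \<and> (\<forall>i\<in>{a..b}. z (s + i) = z1 i)))"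
    if "finite Q" "Q \<subseteq> W" for Q using that
  proof (induction Q rule: finite_induct)
    case empty
    show ?case using y0 by (intro bexI[of _ y0] exI[of _ N]) (auto simp: sees_def)
  next
    case (insert p Q)
    then obtain y1 L where y1: "y1 \<in> \<Phi> ` Z" "L \<ge> N" "sees y0 N y1 0"
      and Q: "\<And>y t z. doubly_transitive (\<Phi> ` Z) y \<Longrightarrow> (\<forall>i\<in>{-N..L}. y (t + i) = y1 i) \<Longrightarrow>
             z \<in> lifts y \<Longrightarrow> local_block z t \<in> Q \<Longrightarrow>
             (\<exists>s. t \<le> s + a \<and> s + b \<le> t + L \<and> (\<forall>i\<in>{a..b}. z (s + i) = z1 i))" by blast
    obtain z2 where z2: "z2 \<in> lifts y1" "local_block z2 0 = p"
      using magic_lift[OF m y1(1,3)] insert.prems by blast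
    then have z2Z: "z2 \<in> Z" "\<Phi> z2 = y1" by (auto simp: lifts_def)
    \<comment> \<open>\<open>z3\<close> follows the old lift through the old word and then shows the block of \<open>z1\<close> at \<open>t3\<close>.\<close>
    obtain z3 t3 where z3: "z3 \<in> Z" "\<forall>i\<le>L + r. z3 i = z2 i" "t3 > L + r + \<bar>a\<bar>"
       "\<forall>i\<ge>-\<bar>a\<bar>. z3 (t3 + i) = z1 i" using trans[OF z2Z(1) z1, of "L + r" "\<bar>a\<bar>"] by blast
    define T where "T = max (t3 + \<bar>b\<bar>) (L + r)"
    \<comment> \<open>\<open>z4\<close> follows \<open>z3\<close> beyond that block and then shows the magic word at \<open>t4\<close>.\<close>
    obtain z4 t4 where z4: "z4 \<in> Z" "\<forall>i\<le>T. z4 i = z3 i" "t4 > T + (N + r)"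
       "\<forall>i\<ge>-(N + r). z4 (t4 + i) = z0 i" using trans[OF z3(1) z0(1), of T "N + r"] by blast
    have old: "z4 i = z2 i" if "i \<le> L + r" for i using z3 z4 that by (simp add: T_def)
    have block: "z4 (t3 + i) = z1 i" if "i \<in> {a..b}" for i
      using z3(4) z4(2) that by (auto simp: T_def)
    have old_img: "\<Phi> z4 i = y1 i" if "i \<le> L" for i
      using \<Phi>_local[OF z4(1) z2Z(1), of i] z2Z(2) old that by auto
    have new: "sees y0 N (\<Phi> z4) t4"
    proof -
      have "\<Phi> z4 (t4 + l) = y0 l" if "\<bar>l\<bar> \<le> N" for l
      proof -
        have "z4 (l + k + t4) = z0 (l + k)" if "\<bar>k\<bar> \<le> r" for k
          using z4(4)[rule_format, of "l + k"] that \<open>\<bar>l\<bar> \<le> N\<close> by (simp add: add.commute)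
        then have "\<Phi> (\<lambda>i. z4 (i + t4)) l = \<Phi> z0 l"
          using \<Phi>_local[OF Z_shift[OF z4(1)] z0(1), of l t4] by blast
        then show ?thesis using \<Phi>_shift[OF z4(1), of t4] z0(2) by (simp add: add.commute)
      qed
      then show ?thesis by (simp add: sees_def)
    qed
    have new0: "sees y0 N (\<Phi> z4) 0" using y1 old_img by (auto simp: sees_def)
    have start: "local_block z4 0 = p" using z2(2) old y1(2) N
      by (auto simp: local_block_eq_iff simp flip: z2(2))
    let ?L = "t4 + N"
    have LL: "?L \<ge> L" using z4(3) N r_nonneg by (auto simp: T_def)
    show ?case
    proof (rule bexI[of _ "\<Phi> z4"], rule exI[of _ ?L], intro conjI allI impI)
      show "\<Phi> z4 \<in> \<Phi> ` Z" using z4(1) by blast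
      show "N \<le> ?L" using LL y1(2) by simp
      show "sees y0 N (\<Phi> z4) 0" by (rule new0)
    next
      fix y t z assume dt: "doubly_transitive (\<Phi> ` Z) y" and yt: "\<forall>i\<in>{-N..?L}. y (t + i) = \<Phi> z4 i"
        and z: "z \<in> lifts y" and w: "local_block z t \<in> insert p Q"
      have y: "y \<in> \<Phi> ` Z" using dt by (simp add: doubly_transitive_def)
      show "\<exists>s. t \<le> s + a \<and> s + b \<le> t + ?L \<and> (\<forall>i\<in>{a..b}. z (s + i) = z1 i)"
      proof (cases "local_block z t \<in> Q")
        case True
        have "\<forall>i\<in>{-N..L}. y (t + i) = y1 i" using yt LL old_img by auto
        then show ?thesis using Q[OF dt _ z True] LL by force
      next
        case False
        then have zp: "local_block z t = local_block z4 0" using w start by simp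
        have s0: "sees y0 N y t"
          using sees_transfer[OF new0 yt] LL y1(2) by simp
        have s4: "sees y0 N y (t + t4)" 
          by (rule sees_transfer[OF new yt]) (use LL y1(2) N z4(3) r_nonneg in \<open>auto simp: T_def\<close>)
        obtain c where c: "c \<in> lifts y" "local_block c (t + t4) = local_block z4 t4"
          using magic_lift[OF m y s4] magic_block[OF m new, of z4] z4(1) by (auto simp: lifts_def)
        \<comment> \<open>Between the two magic places the lift \<open>z\<close> can be replaced by the path \<open>z4\<close>, and the future is unique.\<close>
        let ?u = "\<lambda>l. z4 (l + (-t))"
        let ?g = "\<lambda>l. if l \<le> t then z l else if l \<le> t + t4 then ?u l else c l"
        have t4: "0 \<le> t4" using LL y1(2) N z4(3) by (auto simp: T_def)
        have "?g \<in> lifts y"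
        proof (rule sandwich[OF z c(1) Z_shift[OF z4(1)]])
          show "local_block z t = local_block ?u t" using zp by (subst local_block_shift) simp
          show "local_block c (t + t4) = local_block ?u (t + t4)" using c by (subst local_block_shift) simp
          fix l assume "t \<le> l" "l \<le> t + t4"
          then show "\<Phi> ?u l = y l" using \<Phi>_shift[OF z4(1), of "-t"] yt N
            by (auto dest: bspec[of _ _ "l - t"])
        qed (use t4 in auto)
        moreover have "local_block z t = local_block ?g t"
        proof -
          have "z (t + k) = ?g (t + k)" if "\<bar>k\<bar> \<le> r" for k
            using zp that z4(3) y1(2) N LL by (auto simp: local_block_eq_iff T_def)
          then show ?thesis by (simp add: local_block_eq_iff)
        qed
        ultimately have fut: "z l = ?g l" if "t \<le> l" for l
          using future_determined[OF m dt s0 z] that by blast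
        have "z (t + t3 + i) = z1 i" if "i \<in> {a..b}" for i
        proof -
          have "t < t + t3 + i" "t + t3 + i \<le> t + t4" 
            using that z3(3) z4(3) y1(2) N r_nonneg by (auto simp: T_def)
          then show ?thesis using fut[of "t + t3 + i"] block[OF that] by (auto simp: ac_simps)
        qed
        moreover have "t \<le> t + t3 + a" "t + t3 + b \<le> t + ?L"
          using z3(3) z4(3) y1(2) N r_nonneg by (auto simp: T_def)
        ultimately show ?thesis by blast
      qed
    qed
  qed
  from this[OF finW order_refl] obtain y1 L where y1: "y1 \<in> \<Phi> ` Z" "L \<ge> N" "sees y0 N y1 0"
      and Q: "\<And>y t z. doubly_transitive (\<Phi> ` Z) y \<Longrightarrow> (\<forall>i\<in>{-N..L}. y (t + i) = y1 i) \<Longrightarrow>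
             z \<in> lifts y \<Longrightarrow> local_block z t \<in> W \<Longrightarrow>
             (\<exists>s. t \<le> s + a \<and> s + b \<le> t + L \<and> (\<forall>i\<in>{a..b}. z (s + i) = z1 i))" by blast
  have occ: "\<exists>s. t \<le> s + a \<and> s + b \<le> t + L \<and> (\<forall>i\<in>{a..b}. z (s + i) = z1 i)"
    if "\<forall>i\<in>{-N..L}. y (t + i) = y1 i" for t
  proof -
    have "sees y0 N y t" using sees_transfer[OF y1(3) that] y1(2) by simp
    then show ?thesis using Q[OF dt that z] magic_block[OF m _ z] by blast
  qed
  obtain t where "t \<ge> K + a" "\<forall>i\<in>{-N..L}. y (t + i) = y1 i"
    using doubly_transitive_recurs(1)[OF dt y1(1)] by blast
  moreover from this(2) obtain s where "t \<le> s + a" "\<forall>i\<in>{a..b}. z (s + i) = z1 i"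
    using occ by blast
  ultimately show "\<exists>t\<ge>K. \<forall>i\<in>{a..b}. z (t + i) = z1 i" by (intro exI[of _ s]) auto
  obtain t where "t \<le> K + b - L" "\<forall>i\<in>{-N..L}. y (t + i) = y1 i"
    using doubly_transitive_recurs(2)[OF dt y1(1)] by blast
  moreover from this(2) obtain s where "s + b \<le> t + L" "\<forall>i\<in>{a..b}. z (s + i) = z1 i"
    using occ by blast
  ultimately show "\<exists>t\<le>K. \<forall>i\<in>{a..b}. z (t + i) = z1 i" by (intro exI[of _ s]) auto
qed

end

section \<open>The cover of a sofic shift by synchronizing follower sets\<close>

definition follower :: "(int \<Rightarrow> 'a) set \<Rightarrow> 'a list \<Rightarrow> 'a list set" where
  "follower X w = {v. w @ v \<in> language X}"

lemma follower_append: "follower X (u @ w) = {v. w @ v \<in> follower X u}"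
  by (simp add: follower_def)

text \<open>
What may follow \<open>w\<close> depends only on the set of vertices at which walks labelled \<open>w\<close> can end,
because two bi-infinite walks through the same vertex can be exchanged there.
\<close>

lemma finite_followers:
  assumes "sofic_shift X"
  shows "finite (range (follower X))"
proof -
  obtain E :: "(nat \<times> 'a \<times> nat) set" where E: "finite E"
    "X = {x. \<exists>v :: int \<Rightarrow> nat. \<forall>i. (v i, x i, v (i + 1)) \<in> E}" and X: "shift_space X"
    using assms by (auto simp: sofic_shift_def)
  define walk where "walk x v \<longleftrightarrow> (\<forall>i. (v i, x i, v (i + 1)) \<in> E)" for x :: "int \<Rightarrow> 'a" and v :: "int \<Rightarrow> nat"
  have walk_X: "x \<in> X" if "walk x v" for x v using that E(2) by (auto simp: walk_def)
  define T where "T w = {v 0 |x v. walk x v \<and> occurs_at w x (- int (length w))}" for w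
  define H where "H Q = {u. \<exists>x v. walk x v \<and> v 0 \<in> Q \<and> occurs_at u x 0}" for Q
  have "follower X w = H (T w)" for w
  proof (intro equalityI subsetI)
    fix u assume "u \<in> follower X w"
    then obtain x where x: "x \<in> X" "occurs_at (w @ u) x (- int (length w))"
      using language_occurs_at[OF X] by (auto simp: follower_def)
    then obtain v where "walk x v" using E(2) by (auto simp: walk_def)
    then show "u \<in> H (T w)" using x(2) by (auto simp: H_def T_def occurs_at_append)
  next
    fix u assume "u \<in> H (T w)"
    then obtain x v x' v' where a: "walk x v" "occurs_at u x 0" and b: "walk x' v'"
       "occurs_at w x' (- int (length w))" and eq: "v 0 = v' 0" by (auto simp: H_def T_def)
    let ?x = "\<lambda>i. if i < 0 then x' i else x i" and ?v = "\<lambda>i. if i < 0 then v' i else v i"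
    have "walk ?x ?v" unfolding walk_def
    proof
      fix i :: int
      consider "i < -1" | "i = -1" | "i \<ge> 0" by linarith
      then show "(?v i, ?x i, ?v (i + 1)) \<in> E"
        using a(1) b(1) eq by cases (auto simp: walk_def dest: spec[of _ "-1"])
    qed
    then have "?x \<in> X" by (rule walk_X)
    moreover have "occurs_at (w @ u) ?x (- int (length w))"
      unfolding occurs_at_append
    proof
      show "occurs_at w ?x (- int (length w))" using b(2) by (simp add: occurs_at_def)
      show "occurs_at u ?x (- int (length w) + int (length w))" using a(2) by (simp add: occurs_at_def)
    qed
    ultimately show "u \<in> follower X w" unfolding follower_def language_def by blast
  qed
  then have "range (follower X) \<subseteq> H ` Pow (fst ` E)"
    by (force simp: T_def walk_def)
  then show ?thesis using E(1) by (meson finite_Pow_iff finite_imageI finite_subset)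
qed

definition synchronizing :: "(int \<Rightarrow> 'a) set \<Rightarrow> 'a list \<Rightarrow> bool" where
  "synchronizing X s \<longleftrightarrow> s \<in> language X \<and> (\<forall>u. u @ s \<in> language X \<longrightarrow> follower X (u @ s) = follower X s)"

text \<open>
Prepending letters only shrinks a follower set, so a word whose follower set is minimal among the
finitely many is synchronizing.
\<close>

lemma synchronizing_exists:
  assumes "sofic_shift X" "X \<noteq> {}"
  shows "\<exists>s. synchronizing X s"
proof -
  have "[] \<in> language X" using assms(2) by (auto simp: language_def occurs_at_def)
  then have "follower X ` language X \<noteq> {}" by blast
  moreover have "finite (follower X ` language X)"
    using finite_followers[OF assms(1)] by (rule finite_subset[rotated]) auto
  ultimately obtain F where F: "F \<in> follower X ` language X"
    "\<And>F'. F' \<in> follower X ` language X \<Longrightarrow> F' \<subseteq> F \<Longrightarrow> F' = F"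
    using finite_has_minimal[of "follower X ` language X"] by metis
  then obtain s where s: "s \<in> language X" "F = follower X s" by blast
  have "follower X (u @ s) \<subseteq> follower X s" for u
    using language_appendD2 by (auto simp: follower_def)
  then have "synchronizing X s" using F(2) s by (auto simp: synchronizing_def)
  then show ?thesis ..
qed

lemma synchronizing_append_right:
  assumes s: "synchronizing X s" and "s @ w \<in> language X"
  shows "synchronizing X (s @ w)"
proof -
  have "follower X (u @ s @ w) = follower X (s @ w)" if "u @ s @ w \<in> language X" for u
  proof -
    have "u @ s \<in> language X" using language_appendD1[of "u @ s" w] that by simp
    then have "follower X (u @ s) = follower X s" using s by (simp add: synchronizing_def)
    then show ?thesis using follower_append[of X "u @ s" w] follower_append[of X s w] by simp
  qed
  then show ?thesis using assms by (simp add: synchronizing_def)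
qed

definition sync_states :: "(int \<Rightarrow> 'a) set \<Rightarrow> 'a list set set" where
  "sync_states X = {follower X s |s. synchronizing X s}"

text \<open>
Bi-infinite walks on the deterministic graph whose states are the follower sets of synchronizing
words. The state at \<open>i\<close> records which words may be read from \<open>i\<close> on, and reading the letter
\<open>a\<close> leads from a state \<open>F\<close> to \<open>{v. a # v \<in> F}\<close>.
\<close>

definition sync_cover :: "(int \<Rightarrow> 'a) set \<Rightarrow> (int \<Rightarrow> 'a \<times> 'a list set) set" where
  "sync_cover X = {z. \<forall>i. snd (z i) \<in> sync_states X \<and> [fst (z i)] \<in> snd (z i) \<and>
      snd (z (i + 1)) = {v. fst (z i) # v \<in> snd (z i)}}"

definition label :: "(int \<Rightarrow> 'a \<times> 'b) \<Rightarrow> int \<Rightarrow> 'a" where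
  "label z = (\<lambda>i. fst (z i))"

lemma finite_sync_states: "sofic_shift X \<Longrightarrow> finite (sync_states X)"
  using finite_followers by (rule finite_subset[rotated]) (auto simp: sync_states_def)

lemma sync_cover_state: "z \<in> sync_cover X \<Longrightarrow> snd (z i) \<in> sync_states X"
  by (simp add: sync_cover_def)

text \<open>
Membership is a condition on pairs of adjacent symbols, so a limit of sequences that
obey it on growing blocks is a walk.
\<close>

lemma sync_cover_closed:
  assumes "\<And>N. \<exists>z'. (\<forall>i. \<bar>i\<bar> \<le> N \<longrightarrow> z' i = z i) \<and> (\<forall>i. \<bar>i\<bar> < N \<longrightarrow> snd (z' i) \<in> sync_states X \<and>
      [fst (z' i)] \<in> snd (z' i) \<and> snd (z' (i + 1)) = {v. fst (z' i) # v \<in> snd (z' i)})"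
  shows "z \<in> sync_cover X"
  unfolding sync_cover_def
proof (intro CollectI allI)
  fix i :: int
  obtain z' where z': "\<forall>j. \<bar>j\<bar> \<le> \<bar>i\<bar> + 1 \<longrightarrow> z' j = z j"
    "\<forall>j. \<bar>j\<bar> < \<bar>i\<bar> + 1 \<longrightarrow> snd (z' j) \<in> sync_states X \<and>
      [fst (z' j)] \<in> snd (z' j) \<and> snd (z' (j + 1)) = {v. fst (z' j) # v \<in> snd (z' j)}"
    using assms[of "\<bar>i\<bar> + 1"] by blast
  have "z' i = z i" "z' (i + 1) = z (i + 1)" using z'(1) by auto
  then show "snd (z i) \<in> sync_states X \<and>
      [fst (z i)] \<in> snd (z i) \<and> snd (z (i + 1)) = {v. fst (z i) # v \<in> snd (z i)}"
    using z'(2)[rule_format, of i] by simp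
qed

lemma label_block_in_state:
  assumes "z \<in> sync_cover X"
  shows "map (label z) [i..i + int n - 1] \<in> snd (z i)"
proof (induction n arbitrary: i)
  case 0
  have "snd (z i) \<in> sync_states X" using assms by (auto simp: sync_cover_def)
  then show ?case by (auto simp: sync_states_def synchronizing_def follower_def)
next
  case (Suc n)
  have "map (label z) [i + 1..i + 1 + int n - 1] \<in> snd (z (i + 1))" by (rule Suc)
  also have "snd (z (i + 1)) = {v. label z i # v \<in> snd (z i)}"
    using assms by (auto simp: sync_cover_def label_def)
  finally show ?case by (simp add: upto_rec1 add.commute)
qed

text \<open>
Every block of labels belongs to a follower set, hence to the language of \<open>X\<close>.
\<close>

lemma label_in_shift:
  assumes X: "shift_space X" and z: "z \<in> sync_cover X"
  shows "label z \<in> X"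
proof (rule closed_contains_limit)
  show "closed X" using X by (simp add: shift_space_def)
  fix N :: int
  let ?n = "nat (2 * N + 1)" and ?w = "map (label z) [-N..N]"
  have "?w \<in> snd (z (-N))"
  proof (cases "N \<ge> 0")
    case True
    then show ?thesis using label_block_in_state[OF z, of "-N" ?n] by simp
  next
    case False
    then show ?thesis using label_block_in_state[OF z, of "-N" 0] by simp
  qed
  moreover have "snd (z (-N)) \<in> sync_states X" using z by (auto simp: sync_cover_def)
  ultimately have "?w \<in> language X"
    using language_appendD2 by (auto simp: sync_states_def follower_def)
  then obtain x where x: "x \<in> X" "occurs_at ?w x (0 + (-N))" using language_occurs_at[OF X] by force
  then have "\<forall>i\<in>{-N..N}. x i = label z i" using occurs_at_map_upto[of "label z" "-N" N x 0] by simp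
  then show "\<exists>x'\<in>X. \<forall>i. \<bar>i\<bar> \<le> N \<longrightarrow> x' i = label z i" using x(1) by (intro bexI[of _ x]) (auto simp: abs_le_iff)
qed

text \<open>
By irreducibility every block of \<open>x\<close> can be preceded by a synchronizing word, which yields states along
that block; a limit of these partial walks is a walk above \<open>x\<close>.
\<close>

lemma label_surjective:
  fixes X :: "(int \<Rightarrow> 'a::{finite,discrete_topology}) set"
  assumes irr: "irreducible_shift X" and sof: "sofic_shift X" and x: "x \<in> X"
  shows "\<exists>z\<in>sync_cover X. label z = x"
proof -
  obtain s where s: "synchronizing X s" using synchronizing_exists[OF sof] x by blast
  have "\<exists>u. synchronizing X u \<and> u @ map x [-int n..int n] \<in> language X" for n
  proof -
    obtain w where "s @ w @ map x [-int n..int n] \<in> language X"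
      using irr s map_upto_in_language[OF x] unfolding irreducible_shift_def synchronizing_def by blast
    moreover from this have "synchronizing X (s @ w)"
      using synchronizing_append_right[OF s] language_appendD1[of "s @ w"] by simp
    ultimately show ?thesis by (metis append.assoc)
  qed
  then obtain u where u: "\<And>n. synchronizing X (u n)" "\<And>n. u n @ map x [-int n..int n] \<in> language X"
    by metis
  \<comment> \<open>The state before position \<open>i\<close>; the index is capped at \<open>n\<close> to keep the word inside the language.\<close>
  define S where "S n i = follower X (u n @ map x [-int n..min i (int n) - 1])" for n i
  have split: "map x [-int n..int n] = map x [-int n..min i (int n) - 1] @ map x [max (- int n) (min i (int n))..int n]" for n i
  proof (cases "- int n < i")
    case True
    then show ?thesis by (subst map_append[symmetric], subst upto_split1[of _ "min i (int n)"]) auto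
  qed auto
  have sync: "synchronizing X (u n @ map x [-int n..min i (int n) - 1])" for n i
  proof (rule synchronizing_append_right[OF u(1)])
    show "u n @ map x [-int n..min i (int n) - 1] \<in> language X"
      by (rule language_appendD1[of _ "map x [max (- int n) (min i (int n))..int n]"])
        (use u(2)[of n] split[of n i] in simp)
  qed
  define f where "f n i = (x i, S n i)" for n i
  have "f n i \<in> UNIV \<times> sync_states X" for n i using sync by (auto simp: f_def S_def sync_states_def)
  moreover have "finite ((UNIV :: 'a set) \<times> sync_states X)" using finite_sync_states[OF sof] by simp
  ultimately obtain g where g: "\<And>N. \<exists>n. N \<le> int n \<and> (\<forall>i. \<bar>i\<bar> \<le> N \<longrightarrow> f n i = g i)"
    using finite_valued_sequences_have_limit[of "UNIV \<times> sync_states X" f] by blast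
  have "g \<in> sync_cover X"
  proof (rule sync_cover_closed)
    fix N
    obtain n where n: "N \<le> int n" "\<forall>i. \<bar>i\<bar> \<le> N \<longrightarrow> f n i = g i" using g by blast
    have "snd (f n i) \<in> sync_states X \<and> [fst (f n i)] \<in> snd (f n i) \<and>
       snd (f n (i + 1)) = {v. fst (f n i) # v \<in> snd (f n i)}" if "\<bar>i\<bar> < N" for i
    proof -
      have i: "min i (int n) = i" "min (i + 1) (int n) = i + 1" using that n(1) by auto
      have ext: "map x [- int n..i] = map x [- int n..i - 1] @ [x i]"
        using that n(1) by (subst upto_rec2) auto
      have "u n @ map x [- int n..i - 1] @ [x i] \<in> language X"
        using language_appendD1[of "u n @ map x [- int n..i]"] u(2)[of n] split[of n "i + 1"] ext i
        by simp
      then have "[x i] \<in> S n i" by (simp add: S_def follower_def i)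
      moreover have "S n (i + 1) = {v. x i # v \<in> S n i}"
        by (simp add: S_def i ext follower_def)
      moreover have "S n i \<in> sync_states X" using sync by (auto simp: S_def sync_states_def)
      ultimately show ?thesis by (simp add: f_def)
    qed
    then show "\<exists>z'. (\<forall>i. \<bar>i\<bar> \<le> N \<longrightarrow> z' i = g i) \<and> (\<forall>i. \<bar>i\<bar> < N \<longrightarrow> snd (z' i) \<in> sync_states X \<and>
      [fst (z' i)] \<in> snd (z' i) \<and> snd (z' (i + 1)) = {v. fst (z' i) # v \<in> snd (z' i)})"
      using n(2) by (intro exI[of _ "f n"]) auto
  qed
  moreover have "label g = x"
  proof
    fix i
    obtain n where "\<forall>j. \<bar>j\<bar> \<le> \<bar>i\<bar> \<longrightarrow> f n j = g j" using g[of "\<bar>i\<bar>"] by auto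
    then have "f n i = g i" by simp
    then show "label g i = x i" by (simp add: label_def f_def flip: \<open>f n i = g i\<close>)
  qed
  ultimately show ?thesis by blast
qed

text \<open>
The graph is deterministic, so walks with the same labels and the same state at one position agree
from there on. Hence there are at most as many lifts as states.
\<close>

lemma label_finite_to_one:
  assumes "sofic_shift X"
  shows "finite {z \<in> sync_cover X. label z = x}"
proof -
  have "card G \<le> card (sync_states X)"
    if G: "G \<subseteq> {z \<in> sync_cover X. label z = x}" "finite G" for G
  proof -
    obtain T where T: "\<forall>u\<in>G. \<forall>v\<in>G. (\<forall>l. \<bar>l\<bar> \<le> T \<longrightarrow> u l = v l) \<longrightarrow> u = v"
      using finite_functions_separated[OF G(2)] by blast
    have "inj_on (\<lambda>z. snd (z (-T))) G"
    proof (rule inj_onI)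
      fix u v assume uv: "u \<in> G" "v \<in> G" "snd (u (-T)) = snd (v (-T))"
      then have cov: "u \<in> sync_cover X" "v \<in> sync_cover X" and lab: "label u = label v" using G(1) by auto
      have fst: "fst (u l) = fst (v l)" for l using fun_cong[OF lab, of l] by (simp add: label_def)
      have "snd (u (-T + int k)) = snd (v (-T + int k))" for k
      proof (induction k)
        case (Suc k)
        have "snd (u (-T + int k + 1)) = snd (v (-T + int k + 1))"
          using cov Suc fst[of "-T + int k"] by (simp add: sync_cover_def)
        then show ?case by (simp add: ac_simps)
      qed (use uv in simp)
      then have "snd (u l) = snd (v l)" if "-T \<le> l" for l
        using that by (metis add.commute diff_add_cancel zle_iff_zadd)
      then have "u l = v l" if "\<bar>l\<bar> \<le> T" for l using fst that by (intro prod_eqI) auto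
      then show "u = v" using T uv by blast
    qed
    moreover have "(\<lambda>z. snd (z (-T))) ` G \<subseteq> sync_states X" using G(1) by (auto simp: sync_cover_def)
    ultimately show ?thesis
      using finite_sync_states[OF assms] by (metis card_image card_mono)
  qed
  then show ?thesis using finite_if_finite_subsets_card_bdd by blast
qed

text \<open>
Two synchronizing words \<open>s\<close> and \<open>s1\<close> are connected by some \<open>u\<close> with \<open>s @ u @ s1\<close> in the language, and
synchronization gives \<open>s @ u @ s1\<close> the same follower set as \<open>s1\<close>. So the graph is strongly connected.
\<close>

lemma sync_cover_transitive:
  assumes irr: "irreducible_shift X" and z: "z \<in> sync_cover X" and z1: "z1 \<in> sync_cover X"
  shows "\<exists>z'\<in>sync_cover X. (\<forall>i\<le>T. z' i = z i) \<and> (\<exists>t>T + K. \<forall>i\<ge>-K. z' (t + i) = z1 i)"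
proof -
  obtain s where s: "synchronizing X s" "snd (z (T + 1)) = follower X s"
    using sync_cover_state[OF z, of "T + 1"] unfolding sync_states_def by blast
  obtain s1 where s1: "synchronizing X s1" "snd (z1 (-K)) = follower X s1"
    using sync_cover_state[OF z1, of "-K"] unfolding sync_states_def by blast
  obtain u where u: "s @ u @ s1 \<in> language X"
    using irr s(1) s1(1) unfolding irreducible_shift_def synchronizing_def by blast
  define w where "w = u @ s1"
  have sw: "s @ w \<in> language X" "follower X (s @ w) = follower X s1"
    using u s1(1)[unfolded synchronizing_def, THEN conjunct2, rule_format, of "s @ u"]
    by (simp_all add: w_def)
  define S where "S k = follower X (s @ take k w)" for k
  have S: "S k \<in> sync_states X" for k
  proof -
    have "s @ take k w \<in> language X"
      using language_appendD1[of "s @ take k w" "drop k w"] sw(1) by simp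
    then show ?thesis using synchronizing_append_right[OF s(1)] by (auto simp: S_def sync_states_def)
  qed
  have S_step: "[w ! k] \<in> S k" "S (Suc k) = {v. (w ! k) # v \<in> S k}" if "k < length w" for k
  proof -
    have "s @ take k w @ [w ! k] @ drop (Suc k) w \<in> language X"
      using sw(1) that by (simp add: id_take_nth_drop[symmetric])
    then show "[w ! k] \<in> S k" using language_appendD1[of "s @ take k w @ [w ! k]"]
      by (simp add: S_def follower_def)
    show "S (Suc k) = {v. (w ! k) # v \<in> S k}"
      using that by (simp add: S_def follower_def take_Suc_conv_app_nth)
  qed
  define n where "n = int (length w)"
  define t where "t = T + 1 + n + K"
  define z' where "z' i = (if i \<le> T then z i else if i \<le> T + n
      then (w ! nat (i - T - 1), S (nat (i - T - 1))) else z1 (i - t))" for i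
  have snd_z': "snd (z' (T + 1 + int k)) = S k" if "k \<le> length w" for k
  proof (cases "k < length w")
    case True then show ?thesis by (simp add: z'_def n_def)
  next
    case False
    then have "k = length w" using that by simp
    then show ?thesis using s1(2) sw(2) by (simp add: z'_def n_def t_def S_def)
  qed
  have "z' \<in> sync_cover X"
    unfolding sync_cover_def
  proof (intro CollectI allI)
    fix i
    consider "i < T" | "i = T" | k where "i = T + 1 + int k" "k < length w" | "i > T + n"
    proof (cases "T < i \<and> i \<le> T + n")
      case True
      then have "i = T + 1 + int (nat (i - T - 1))" "nat (i - T - 1) < length w" by (auto simp: n_def)
      then show ?thesis using that by blast
    qed (use that in linarith)
    then show "snd (z' i) \<in> sync_states X \<and> [fst (z' i)] \<in> snd (z' i) \<and>
        snd (z' (i + 1)) = {v. fst (z' i) # v \<in> snd (z' i)}"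
    proof cases
      case 1
      then have "z' i = z i" "z' (i + 1) = z (i + 1)" by (auto simp: z'_def)
      then show ?thesis using z by (simp add: sync_cover_def)
    next
      case 2
      have "z' i = z i" "snd (z' (i + 1)) = snd (z (i + 1))"
        using 2 snd_z'[of 0] s(2) by (auto simp: z'_def S_def)
      then show ?thesis using z by (simp add: sync_cover_def)
    next
      case 3
      then have "z' i = (w ! k, S k)" by (simp add: z'_def n_def)
      moreover have "snd (z' (i + 1)) = S (Suc k)" using snd_z'[of "Suc k"] 3 by (simp add: ac_simps)
      ultimately show ?thesis using S S_step[OF 3(2)] by simp
    next
      case 4
      then have "i > T" "i + 1 > T" by (auto simp: n_def)
      with 4 have "z' i = z1 (i - t)" "z' (i + 1) = z1 (i - t + 1)" by (auto simp: z'_def algebra_simps)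
      then show ?thesis using z1 by (simp add: sync_cover_def)
    qed
  qed
  moreover have "\<forall>i\<ge>-K. z' (t + i) = z1 i" by (auto simp: z'_def t_def n_def)
  moreover have "t > T + K" by (simp add: t_def n_def)
  moreover have "\<forall>i\<le>T. z' i = z i" by (simp add: z'_def)
  ultimately show ?thesis by blast
qed

lemma sync_cover_markov_code:
  fixes X :: "(int \<Rightarrow> 'a::{finite,discrete_topology}) set"
  assumes X: "shift_space X" and sof: "sofic_shift X" and r: "0 \<le> r"
    and loc: "\<And>x x' i. x \<in> X \<Longrightarrow> x' \<in> X \<Longrightarrow> (\<And>k. \<bar>k\<bar> \<le> r \<Longrightarrow> x (i + k) = x' (i + k)) \<Longrightarrow> \<pi> x i = \<pi> x' i"
    and shift: "\<And>x k. x \<in> X \<Longrightarrow> \<pi> (\<lambda>i. x (i + k)) = (\<lambda>i. \<pi> x (i + k))"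
    and fin: "\<And>y. finite (fibre \<pi> X y)"
  shows "markov_code (sync_cover X) (UNIV \<times> sync_states X) (\<lambda>z. \<pi> (label z)) r"
proof unfold_locales
  note lab = label_in_shift[OF X]
  show "finite ((UNIV :: 'a set) \<times> sync_states X)" using finite_sync_states[OF sof] by simp
  show "z i \<in> UNIV \<times> sync_states X" if "z \<in> sync_cover X" for z i
    using that by (cases "z i") (force simp: sync_cover_def dest: spec[of _ i])
  show "z \<in> sync_cover X" if lim: "\<And>N. \<exists>z'\<in>sync_cover X. \<forall>i. \<bar>i\<bar> \<le> N \<longrightarrow> z' i = z i" for z
  proof (rule sync_cover_closed)
    fix N
    obtain z' where "z' \<in> sync_cover X" "\<forall>i. \<bar>i\<bar> \<le> N \<longrightarrow> z' i = z i" using lim[of N] by blast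
    then show "\<exists>z'. (\<forall>i. \<bar>i\<bar> \<le> N \<longrightarrow> z' i = z i) \<and> (\<forall>i. \<bar>i\<bar> < N \<longrightarrow> snd (z' i) \<in> sync_states X \<and>
      [fst (z' i)] \<in> snd (z' i) \<and> snd (z' (i + 1)) = {v. fst (z' i) # v \<in> snd (z' i)})"
      unfolding sync_cover_def by (intro exI[of _ z']) blast
  qed
  show "(\<lambda>i. z (i + k)) \<in> sync_cover X" if "z \<in> sync_cover X" for z k
  proof -
    have "snd (z (i + k)) \<in> sync_states X \<and> [fst (z (i + k))] \<in> snd (z (i + k)) \<and>
        snd (z (i + k + 1)) = {v. fst (z (i + k)) # v \<in> snd (z (i + k))}" for i
      using that unfolding sync_cover_def by blast
    then show ?thesis by (simp add: sync_cover_def ac_simps)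
  qed
  show "(\<lambda>l. if l \<le> i then z l else z' l) \<in> sync_cover X"
    if z: "z \<in> sync_cover X" "z' \<in> sync_cover X" and eq: "z i = z' i" for z z' i
    unfolding sync_cover_def
  proof (intro CollectI allI)
    fix l
    let ?g = "\<lambda>l. if l \<le> i then z l else z' l"
    consider "l < i" | "l = i" | "l > i" by linarith
    then show "snd (?g l) \<in> sync_states X \<and> [fst (?g l)] \<in> snd (?g l) \<and>
        snd (?g (l + 1)) = {v. fst (?g l) # v \<in> snd (?g l)}"
      using z eq by cases (auto simp: sync_cover_def)
  qed
  show "0 \<le> r" by (rule r)
  show "\<pi> (label z) i = \<pi> (label z') i"
    if "z \<in> sync_cover X" "z' \<in> sync_cover X" "\<And>k. \<bar>k\<bar> \<le> r \<Longrightarrow> z (i + k) = z' (i + k)" for z z' i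
    using that by (intro loc lab) (auto simp: label_def)
  show "\<pi> (label (\<lambda>i. z (i + k))) = (\<lambda>i. \<pi> (label z) (i + k))" if "z \<in> sync_cover X" for z k
    using shift[OF lab[OF that], of k] by (simp add: label_def)
  show "finite {z \<in> sync_cover X. \<pi> (label z) = y}" for y
  proof (rule finite_subset)
    show "{z \<in> sync_cover X. \<pi> (label z) = y} \<subseteq> (\<Union>x\<in>fibre \<pi> X y. {z \<in> sync_cover X. label z = x})"
      using lab by (auto simp: fibre_def)
    show "finite (\<Union>x\<in>fibre \<pi> X y. {z \<in> sync_cover X. label z = x})"
      using fin label_finite_to_one[OF sof] by blast
  qed
qed

section \<open>The degree of a finite-to-one code\<close>

text \<open>
Above a doubly transitive \<open>y\<close> lie \<open>dP\<close> points of the cover. They are distributed over the preimages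
of \<open>y\<close> in \<open>X\<close>, and above each of these lie \<open>dL\<close> of them because it is doubly transitive as well.
\<close>

theorem card_fibre_constant:
  fixes X :: "(int \<Rightarrow> 'a::{finite,discrete_topology}) set"
    and Y :: "(int \<Rightarrow> 'b::{finite,discrete_topology}) set"
  assumes irr: "irreducible_shift X" and sof: "sofic_shift X"
    and code: "factor_code \<pi> X Y" and fin: "finite_to_one \<pi> X Y"
  shows "\<exists>d. \<forall>y. doubly_transitive Y y \<longrightarrow> card (fibre \<pi> X y) = d"
proof -
  have X: "shift_space X" and cl: "closed X" and cont: "continuous_on X \<pi>" and im: "\<pi> ` X = Y"
    using code by (auto simp: factor_code_def shift_space_def)
  note translate = factor_code_translate[OF code]
  obtain r where r: "r \<ge> 0"
    "\<And>x x'. x \<in> X \<Longrightarrow> x' \<in> X \<Longrightarrow> (\<And>k. \<bar>k\<bar> \<le> r \<Longrightarrow> x k = x' k) \<Longrightarrow> \<pi> x 0 = \<pi> x' 0"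
    using continuous_block_radius[OF cl cont] by metis
  have loc: "\<pi> x i = \<pi> x' i" if x: "x \<in> X" "x' \<in> X" and eq: "\<And>k. \<bar>k\<bar> \<le> r \<Longrightarrow> x (i + k) = x' (i + k)" for x x' i
    using r(2)[OF shift_space_translate[OF X x(1), of i] shift_space_translate[OF X x(2), of i]] eq
      translate[OF x(1), of i] translate[OF x(2), of i] by (simp add: add.commute)
  have fin': "finite (fibre \<pi> X y)" for y
  proof (cases "y \<in> Y")
    case False
    then have "fibre \<pi> X y = {}" using im by (auto simp: fibre_def)
    then show ?thesis by simp
  qed (use fin in \<open>simp add: finite_to_one_def\<close>)
  interpret P: markov_code "sync_cover X" "UNIV \<times> sync_states X" "\<lambda>z. \<pi> (label z)" r
    by (rule sync_cover_markov_code[OF X sof r(1) loc translate fin'])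
  interpret L: markov_code "sync_cover X" "UNIV \<times> sync_states X" label 0
    by (rule sync_cover_markov_code[OF X sof, where \<pi> = "\<lambda>x. x"]) (auto simp: fibre_def dest: spec[of _ 0])
  have lab: "label ` sync_cover X = X"
    using label_in_shift[OF X] label_surjective[OF irr sof] by blast
  have P_im: "(\<lambda>z. \<pi> (label z)) ` sync_cover X = Y"
    by (metis (no_types, lifting) im image_cong image_image lab)
  obtain dP where dP: "\<And>y. doubly_transitive Y y \<Longrightarrow> card (P.lifts y) = dP"
    using P.card_lifts_constant P_im by auto
  obtain dL where dL: "\<And>x. doubly_transitive X x \<Longrightarrow> card (L.lifts x) = dL"
    using L.card_lifts_constant lab by auto
  have "card (fibre \<pi> X y) = dP div dL" if y: "doubly_transitive Y y" for y
  proof -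
    have dt: "doubly_transitive X x" if x: "x \<in> fibre \<pi> X y" for x
    proof -
      obtain z where z: "z \<in> sync_cover X" "label z = x"
        using label_surjective[OF irr sof] x by (auto simp: fibre_def)
      then have zP: "z \<in> P.lifts y" using x by (auto simp: P.lifts_def fibre_def)
      have dtP: "doubly_transitive ((\<lambda>z. \<pi> (label z)) ` sync_cover X) y" using y P_im by simp
      have recur: "\<exists>t\<ge>K. \<forall>i\<in>{a..b}. z (t + i) = z1 i" "\<exists>t\<le>K. \<forall>i\<in>{a..b}. z (t + i) = z1 i"
        if "z1 \<in> sync_cover X" for z1 K a b
        by (rule P.blocks_recur_in_fibres[OF _ dtP zP that], rule sync_cover_transitive[OF irr], assumption+)+
      show ?thesis
      proof (rule doubly_transitiveI)
        show "x \<in> X" using x by (simp add: fibre_def)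
        fix x' a b K assume "x' \<in> X"
        then obtain z1 where z1: "z1 \<in> sync_cover X" "label z1 = x'"
          using label_surjective[OF irr sof] by blast
        have "x (t + i) = x' i" if "z (t + i) = z1 i" for t i
          using that z(2) z1(2) by (auto simp: label_def)
        then show "\<exists>t\<ge>K. \<forall>i\<in>{a..b}. x (t + i) = x' i" "\<exists>t\<le>K. \<forall>i\<in>{a..b}. x (t + i) = x' i"
          using recur[OF z1(1), of K a b] by blast+
      qed
    qed
    have "P.lifts y = (\<Union>x\<in>fibre \<pi> X y. L.lifts x)"
      using label_in_shift[OF X] by (auto simp: P.lifts_def L.lifts_def fibre_def)
    also have "card \<dots> = (\<Sum>x\<in>fibre \<pi> X y. card (L.lifts x))"
      by (rule card_UN_disjoint[OF fin']) (auto simp: L.finite_lifts, auto simp: L.lifts_def)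
    also have "\<dots> = card (fibre \<pi> X y) * dL" using dL dt by simp
    finally have eq: "dP = card (fibre \<pi> X y) * dL" using dP[OF y] by simp
    obtain x where x: "x \<in> fibre \<pi> X y"
      using y im by (auto simp: doubly_transitive_def fibre_def)
    then obtain z where "z \<in> L.lifts x"
      using label_surjective[OF irr sof, of x] by (auto simp: L.lifts_def fibre_def)
    then have "dL > 0" using dL[OF dt[OF x]] L.finite_lifts[of x] by (auto simp: card_gt_0_iff)
    then show ?thesis using eq by simp
  qed
  then show ?thesis by blast
qed

section \<open>Ergodic components of a finite extension\<close>

text \<open>
The level sets on \<open>D\<close> are invariant and countable in number, so one of them has measure one. Ergodicity
speaks only of sets equal to their preimage; this is why the observable has to be invariant at
every point of an invariant \<open>D\<close>.
\<close>

lemma ergodic_nat_observable_constant: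
  fixes n :: "'y \<Rightarrow> nat"
  assumes M: "prob_space M" and erg: "ergodic_measure S M"
    and D: "D \<in> sets M" "emeasure M D = 1" "\<And>y. y \<in> space M \<Longrightarrow> S y \<in> D \<longleftrightarrow> y \<in> D"
    and n: "n \<in> measurable M (count_space UNIV)" and inv: "\<And>y. y \<in> D \<Longrightarrow> n (S y) = n y"
  shows "\<exists>k. AE y in M. n y = k"
proof -
  interpret prob_space M by (rule M)
  define L where "L k = {y \<in> D. n y = k}" for k
  have L_eq: "L k = D \<inter> (n -` {k} \<inter> space M)" for k
    using sets.sets_into_space[OF D(1)] by (auto simp: L_def)
  have sets_L: "L k \<in> sets M" for k
    unfolding L_eq using D(1) measurable_sets[OF n, of "{k}"] by auto
  have "S -` L k \<inter> space M = L k" for k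
    using D(3) inv sets.sets_into_space[OF D(1)] by (auto simp: L_def)
  then have 01: "emeasure M (L k) = 0 \<or> emeasure M (L k) = 1" for k
    using erg sets_L by (auto simp: ergodic_measure_def)
  have "\<exists>k. emeasure M (L k) \<noteq> 0"
  proof (rule ccontr)
    assume "\<nexists>k. emeasure M (L k) \<noteq> 0"
    then have "emeasure M (\<Union>k. L k) = 0" using sets_L by (intro emeasure_UN_eq_0) auto
    moreover have "(\<Union>k. L k) = D" by (auto simp: L_def)
    ultimately show False using D(2) by simp
  qed
  then obtain k where "emeasure M (L k) = 1" using 01 by blast
  then have "AE y in M. y \<in> L k"
    using AE_in_set_eq_1[OF sets_L] by (simp add: measure_def)
  then show ?thesis by (intro exI[of _ k]) (auto simp: L_def)
qed

text \<open>
Over each \<open>y \<in> D\<close> lie the \<open>card I\<close> distinct points \<open>G \<sigma> y\<close>, which \<open>T\<close> permutes along \<open>S\<close>.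
Weighting them equally gives an invariant measure \<open>\<Lambda>0\<close> of total mass \<open>card I\<close> whose values on invariant sets are
natural numbers, so an invariant set \<open>A\<close> of least positive mass exists and carries an ergodic measure.
\<close>

lemma finite_extension_ergodic_component:
  fixes M :: "'y measure" and N :: "'z measure" and I :: "'i set"
  assumes M: "prob_space M" and erg: "ergodic_measure S M"
    and D: "D \<in> sets M" "emeasure M D = 1" "\<And>y. y \<in> space M \<Longrightarrow> S y \<in> D \<longleftrightarrow> y \<in> D"
    and I: "finite I" "I \<noteq> {}"
    and G: "\<And>\<sigma>. \<sigma> \<in> I \<Longrightarrow> G \<sigma> \<in> measurable M N"
    and T: "T \<in> measurable N N"
    and inj: "\<And>y. y \<in> D \<Longrightarrow> inj_on (\<lambda>\<sigma>. G \<sigma> y) I"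
    and bij: "\<And>y. y \<in> D \<Longrightarrow> bij_betw T ((\<lambda>\<sigma>. G \<sigma> y) ` I) ((\<lambda>\<sigma>. G \<sigma> (S y)) ` I)"
  obtains \<Lambda> where "prob_space \<Lambda>" "sets \<Lambda> = sets N" "ergodic_measure T \<Lambda>"
    "\<And>B. B \<in> sets N \<Longrightarrow> (\<And>y \<sigma>. y \<in> D \<Longrightarrow> \<sigma> \<in> I \<Longrightarrow> G \<sigma> y \<in> B) \<Longrightarrow> emeasure \<Lambda> B = 1"
    "\<And>q. q \<in> measurable N M \<Longrightarrow> (\<And>y \<sigma>. y \<in> D \<Longrightarrow> \<sigma> \<in> I \<Longrightarrow> q (G \<sigma> y) = y) \<Longrightarrow> distr \<Lambda> M q = M"
proof -
  interpret prob_space M by (rule M)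
  have S: "S \<in> measurable M M" "distr M M S = M"
    using erg by (auto simp: ergodic_measure_def invariant_measure_def)
  have AE_D: "AE y in M. y \<in> D"
    using AE_in_set_eq_1[OF D(1)] D(2) by (simp add: measure_def)
  have DM: "y \<in> space M" if "y \<in> D" for y using that sets.sets_into_space[OF D(1)] by auto

  \<comment> \<open>For invariant \<open>B\<close> this number is constant along orbits of \<open>S\<close>, which is the core of the argument.\<close>
  define n where "n B y = card {\<sigma> \<in> I. G \<sigma> y \<in> B}" for B y
  have n_sum: "n B y = (\<Sum>\<sigma>\<in>I. indicator B (G \<sigma> y))" for B y
    unfolding n_def using I(1) by (simp add: indicator_def sum.If_cases Int_def)
  have n_meas [measurable]: "n B \<in> measurable M (count_space UNIV)" if "B \<in> sets N" for B
  proof -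
    have "(\<lambda>t. if t \<in> B then 1 else 0 :: nat) \<in> measurable N (count_space UNIV)"
      using that by measurable
    then have "(\<lambda>y. indicator B (G \<sigma> y) :: nat) \<in> measurable M (count_space UNIV)" if "\<sigma> \<in> I" for \<sigma>
      using measurable_compose[OF G[OF that]] by (simp add: indicator_def of_bool_def)
    then show ?thesis unfolding n_sum[abs_def] by (intro measurable_sum_nat)
  qed
  have n_card: "n B y = card ((\<lambda>\<sigma>. G \<sigma> y) ` I \<inter> B)" if "y \<in> D" for B y
  proof -
    have "(\<lambda>\<sigma>. G \<sigma> y) ` I \<inter> B = (\<lambda>\<sigma>. G \<sigma> y) ` {\<sigma> \<in> I. G \<sigma> y \<in> B}" by auto
    moreover have "inj_on (\<lambda>\<sigma>. G \<sigma> y) {\<sigma> \<in> I. G \<sigma> y \<in> B}"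
      using inj[OF that] by (rule inj_on_subset) auto
    ultimately show ?thesis by (simp add: n_def card_image)
  qed
  have n_shift: "n (T -` B \<inter> space N) y = n B (S y)" if y: "y \<in> D" for B y
  proof -
    let ?O = "(\<lambda>\<sigma>. G \<sigma> y) ` I"
    have Sy: "S y \<in> D" using D(3) DM y by blast
    have sp: "?O \<subseteq> space N" using measurable_space[OF G DM[OF y]] by auto
    have "(\<lambda>\<sigma>. G \<sigma> (S y)) ` I \<inter> B = T ` (?O \<inter> (T -` B \<inter> space N))"
      unfolding bij_betw_imp_surj_on[OF bij[OF y], symmetric] using sp by auto
    moreover have "inj_on T (?O \<inter> (T -` B \<inter> space N))"
      using bij_betw_imp_inj_on[OF bij[OF y]] by (rule inj_on_subset) auto
    ultimately show ?thesis by (simp add: n_card y Sy card_image)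
  qed

  define K where "K B = (\<Sum>\<sigma>\<in>I. emeasure M (G \<sigma> -` B \<inter> space M))" for B
  define \<Lambda>0 where "\<Lambda>0 = measure_of (space N) (sets N) K"
  have sets_\<Lambda>0: "sets \<Lambda>0 = sets N" and space_\<Lambda>0: "space \<Lambda>0 = space N"
    by (simp_all add: \<Lambda>0_def sets.sigma_sets_eq sets.space_closed)
  have em_\<Lambda>0: "emeasure \<Lambda>0 B = K B" if "B \<in> sets N" for B
  proof (rule emeasure_measure_of[OF \<Lambda>0_def sets.space_closed])
    show "B \<in> sets \<Lambda>0" using that sets_\<Lambda>0 by simp
    show "positive (sets \<Lambda>0) K" by (simp add: positive_def K_def)
    show "countably_additive (sets \<Lambda>0) K"
    proof (rule countably_additiveI)
      fix A :: "nat \<Rightarrow> 'z set"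
      assume A: "range A \<subseteq> sets \<Lambda>0" "disjoint_family A"
      have "(\<Sum>i. emeasure M (G \<sigma> -` A i \<inter> space M)) = emeasure M (G \<sigma> -` (\<Union>i. A i) \<inter> space M)"
        if "\<sigma> \<in> I" for \<sigma>
      proof (subst suminf_emeasure)
        show "range (\<lambda>i. G \<sigma> -` A i \<inter> space M) \<subseteq> sets M"
          using A(1) sets_\<Lambda>0 measurable_sets[OF G[OF that]] by auto
        show "disjoint_family (\<lambda>i. G \<sigma> -` A i \<inter> space M)"
          using A(2) by (auto simp: disjoint_family_on_def)
      qed (auto intro: arg_cong[where f = "emeasure M"])
      then show "(\<Sum>i. K (A i)) = K (\<Union>i. A i)"
        unfolding K_def by (subst suminf_sum) auto
    qed
  qed
  have em: "emeasure \<Lambda>0 B = (\<integral>\<^sup>+y. of_nat (n B y) \<partial>M)" if B: "B \<in> sets N" for B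
  proof -
    have "(\<integral>\<^sup>+y. of_nat (n B y) \<partial>M) = (\<integral>\<^sup>+y. (\<Sum>\<sigma>\<in>I. indicator (G \<sigma> -` B \<inter> space M) y) \<partial>M)"
      by (intro nn_integral_cong) (auto simp: n_sum indicator_def intro!: sum.cong)
    also have "\<dots> = (\<Sum>\<sigma>\<in>I. \<integral>\<^sup>+y. indicator (G \<sigma> -` B \<inter> space M) y \<partial>M)"
      using measurable_sets[OF G B] by (intro nn_integral_sum) auto
    also have "\<dots> = K B"
      unfolding K_def using measurable_sets[OF G B] by (intro sum.cong) auto
    finally show ?thesis using em_\<Lambda>0[OF B] by simp
  qed
  have em_shift: "emeasure \<Lambda>0 (T -` B \<inter> space N) = emeasure \<Lambda>0 B" if B: "B \<in> sets N" for B
  proof -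
    have "emeasure \<Lambda>0 (T -` B \<inter> space N) = (\<integral>\<^sup>+y. of_nat (n (T -` B \<inter> space N) y) \<partial>M)"
      by (rule em[OF measurable_sets[OF T B]])
    also have "\<dots> = (\<integral>\<^sup>+y. of_nat (n B (S y)) \<partial>M)"
      using AE_D by (intro nn_integral_cong_AE) (auto simp: n_shift)
    also have "\<dots> = (\<integral>\<^sup>+y. of_nat (n B y) \<partial>distr M M S)"
      by (rule nn_integral_distr[symmetric, OF S(1)])
        (use n_meas[OF B] in \<open>simp add: measurable_compose[where g = of_nat]\<close>)
    finally show ?thesis using S(2) em[OF B] by simp
  qed
  have const: "\<exists>k::nat. (AE y in M. n B y = k) \<and> emeasure \<Lambda>0 B = of_nat k"
    if B: "B \<in> sets N" "T -` B \<inter> space N = B" for B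
  proof -
    have "n B (S y) = n B y" if "y \<in> D" for y using n_shift[OF that, of B] B(2) by simp
    then obtain k where k: "AE y in M. n B y = k"
      using ergodic_nat_observable_constant[OF M erg D n_meas[OF B(1)]] by blast
    have "emeasure \<Lambda>0 B = (\<integral>\<^sup>+y. of_nat k \<partial>M)"
      unfolding em[OF B(1)] using k by (intro nn_integral_cong_AE) auto
    then show ?thesis using k by (intro exI[of _ k]) (simp add: emeasure_space_1)
  qed

  \<comment> \<open>The least such mass belongs to an ergodic component.\<close>
  define Q where "Q k \<longleftrightarrow> 0 < k \<and> (\<exists>A\<in>sets N. T -` A \<inter> space N = A \<and> emeasure \<Lambda>0 A = of_nat k)" for k :: nat
  have "Q (card I)"
  proof -
    have "T -` space N \<inter> space N = space N" using measurable_space[OF T] by auto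
    moreover have "n (space N) y = card I" if "y \<in> D" for y
    proof -
      have "{\<sigma> \<in> I. G \<sigma> y \<in> space N} = I" using measurable_space[OF G DM[OF that]] by auto
      then show ?thesis by (simp add: n_def)
    qed
    then have "emeasure \<Lambda>0 (space N) = (\<integral>\<^sup>+y. of_nat (card I) \<partial>M)"
      unfolding em[OF sets.top] using AE_D by (intro nn_integral_cong_AE) auto
    ultimately show ?thesis using I unfolding Q_def
      by (auto simp: card_gt_0_iff emeasure_space_1 intro!: bexI[of _ "space N"])
  qed
  define k where "k = (LEAST k. Q k)"
  have "Q k" unfolding k_def by (rule LeastI) fact
  have k_min: "k \<le> j" if "Q j" for j unfolding k_def using that by (rule Least_le)
  obtain A where A: "A \<in> sets N" "T -` A \<inter> space N = A" "emeasure \<Lambda>0 A = of_nat k" and k: "k > 0"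
    using \<open>Q k\<close> by (auto simp: Q_def)
  have AE_A: "AE y in M. n A y = k"
  proof -
    obtain k' where "AE y in M. n A y = k'" "emeasure \<Lambda>0 A = of_nat k'" using const[OF A(1,2)] by blast
    then show ?thesis using A(3) by simp
  qed
  define \<Lambda> where "\<Lambda> = uniform_measure \<Lambda>0 A"
  have sets_\<Lambda>: "sets \<Lambda> = sets N" and space_\<Lambda>: "space \<Lambda> = space N"
    using sets_\<Lambda>0 space_\<Lambda>0 by (simp_all add: \<Lambda>_def)
  have em_\<Lambda>: "emeasure \<Lambda> B = emeasure \<Lambda>0 (A \<inter> B) / of_nat k" if "B \<in> sets N" for B
    using that A sets_\<Lambda>0 by (simp add: \<Lambda>_def)
  have prob: "prob_space \<Lambda>" unfolding \<Lambda>_def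
    by (rule prob_space_uniform_measure) (use A(3) k in auto)
  have T\<Lambda>: "T \<in> measurable \<Lambda> \<Lambda>"
    using T by (simp add: measurable_cong_sets[OF sets_\<Lambda> sets_\<Lambda>])
  have k_div: "of_nat k / of_nat k = (1 :: ennreal)" by (rule ennreal_divide_self) (use k in \<open>auto simp: of_nat_less_top\<close>)
  show ?thesis
  proof (rule that[OF prob sets_\<Lambda>])
    show "ergodic_measure T \<Lambda>" unfolding ergodic_measure_def invariant_measure_def
    proof (intro conjI ballI impI T\<Lambda>)
      show "distr \<Lambda> \<Lambda> T = \<Lambda>"
      proof (rule measure_eqI)
        fix B assume "B \<in> sets (distr \<Lambda> \<Lambda> T)"
        then have B: "B \<in> sets N" using sets_\<Lambda> by simp
        have eq: "A \<inter> (T -` B \<inter> space N) = T -` (A \<inter> B) \<inter> space N" using A(2) by blast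
        have "emeasure \<Lambda> (T -` B \<inter> space N) = emeasure \<Lambda> B"
          by (simp only: em_\<Lambda>[OF measurable_sets[OF T B]] em_\<Lambda>[OF B] eq em_shift[OF sets.Int[OF A(1) B]])
        then show "emeasure (distr \<Lambda> \<Lambda> T) B = emeasure \<Lambda> B"
          using emeasure_distr[OF T\<Lambda>, of B] B by (simp only: sets_\<Lambda> space_\<Lambda>)
      qed simp
      fix B assume "B \<in> sets \<Lambda>" "T -` B \<inter> space \<Lambda> = B"
      then have B: "B \<in> sets N" "T -` B \<inter> space N = B" by (simp_all only: sets_\<Lambda> space_\<Lambda>)
      have AB: "A \<inter> B \<in> sets N" "T -` (A \<inter> B) \<inter> space N = A \<inter> B"
        using A(1) B(1) A(2) B(2) by blast+
      obtain j where j: "emeasure \<Lambda>0 (A \<inter> B) = of_nat j" using const[OF AB] by blast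
      show "emeasure \<Lambda> B = 0 \<or> emeasure \<Lambda> B = 1"
      proof (cases "j = 0")
        case False
        then have "Q j" unfolding Q_def using j AB by blast
        then have "k \<le> j" by (rule k_min)
        moreover have "emeasure \<Lambda>0 (A \<inter> B) \<le> emeasure \<Lambda>0 A"
          using A(1) sets_\<Lambda>0 by (intro emeasure_mono) auto
        then have "j \<le> k" using j A(3) by simp
        ultimately show ?thesis using em_\<Lambda>[OF B(1)] j k_div by simp
      qed (use em_\<Lambda>[OF B(1)] j in simp)
    qed
  next
    fix B assume B: "B \<in> sets N" and GB: "\<And>y \<sigma>. y \<in> D \<Longrightarrow> \<sigma> \<in> I \<Longrightarrow> G \<sigma> y \<in> B"
    have "n (A \<inter> B) y = n A y" if "y \<in> D" for y
      unfolding n_def using GB[OF that] by (intro arg_cong[where f = card]) auto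
    then have "emeasure \<Lambda>0 (A \<inter> B) = emeasure \<Lambda>0 A"
      unfolding em[OF A(1)] em[OF sets.Int[OF A(1) B]]
      using AE_D by (intro nn_integral_cong_AE) auto
    then show "emeasure \<Lambda> B = 1" using em_\<Lambda>[OF B] A(3) k_div by simp
  next
    fix q assume q: "q \<in> measurable N M" and qG: "\<And>y \<sigma>. y \<in> D \<Longrightarrow> \<sigma> \<in> I \<Longrightarrow> q (G \<sigma> y) = y"
    have q\<Lambda>: "q \<in> measurable \<Lambda> M" using q by (simp add: measurable_cong_sets[OF sets_\<Lambda> refl])
    show "distr \<Lambda> M q = M"
    proof (rule measure_eqI)
      fix C assume "C \<in> sets (distr \<Lambda> M q)"
      then have C: "C \<in> sets M" by simp
      let ?B = "q -` C \<inter> space N"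
      have B: "?B \<in> sets N" using measurable_sets[OF q C] .
      have "of_nat (n (A \<inter> ?B) y) = of_nat k * indicator C y" if "y \<in> D" "n A y = k" for y
      proof -
        have "{\<sigma> \<in> I. G \<sigma> y \<in> A \<inter> ?B} = (if y \<in> C then {\<sigma> \<in> I. G \<sigma> y \<in> A} else {})"
          using qG[OF that(1)] sets.sets_into_space[OF A(1)] by auto
        then show ?thesis using that(2) by (simp add: n_def)
      qed
      then have "emeasure \<Lambda>0 (A \<inter> ?B) = (\<integral>\<^sup>+y. of_nat k * indicator C y \<partial>M)"
        unfolding em[OF sets.Int[OF A(1) B]] using AE_D AE_A by (intro nn_integral_cong_AE) auto
      also have "\<dots> = of_nat k * emeasure M C" using C by (simp add: nn_integral_cmult_indicator)
      finally have "emeasure \<Lambda> ?B = of_nat k * emeasure M C / of_nat k" using em_\<Lambda>[OF B] by simp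
      also have "\<dots> = emeasure M C * (of_nat k / of_nat k)"
        by (simp add: ennreal_times_divide mult.commute)
      finally show "emeasure (distr \<Lambda> M q) C = emeasure M C"
        using q\<Lambda> C k_div space_\<Lambda> by (simp add: emeasure_distr)
    qed simp
  qed
qed

section \<open>Borel structure of a shift space\<close>

lemma space_borel_of [simp]: "space (borel_of T) = topspace T"
  unfolding borel_of_def by (rule space_measure_of) (auto dest: openin_subset)

lemma sets_borel_of_openin: "openin T U \<Longrightarrow> U \<in> sets (borel_of T)"
  unfolding borel_of_def by (subst sets_measure_of) (auto dest: openin_subset)

lemma measurable_borel_of_continuous:
  assumes f: "continuous_map T T' f"
  shows "f \<in> measurable (borel_of T) (borel_of T')"
proof (subst (2) borel_of_def, rule measurable_measure_of)
  show "{U. openin T' U} \<subseteq> Pow (topspace T')" by (auto dest: openin_subset)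
  show "f \<in> space (borel_of T) \<rightarrow> topspace T'" using continuous_map_funspace[OF f] by simp
  fix U assume "U \<in> {U. openin T' U}"
  then have "openin T {x \<in> topspace T. f x \<in> U}" using f by (auto simp: continuous_map_def)
  moreover have "{x \<in> topspace T. f x \<in> U} = f -` U \<inter> space (borel_of T)" by auto
  ultimately show "f -` U \<inter> space (borel_of T) \<in> sets (borel_of T)"
    using sets_borel_of_openin by metis
qed

lemma borel_prob_space:
  assumes "borel_prob T M" shows "space M = topspace T"
  using assms sets_eq_imp_space_eq[of M "borel_of T"] by (simp add: borel_prob_def)

lemma borel_prob_coordinate:
  fixes Y :: "(int \<Rightarrow> 'b::discrete_topology) set"
  assumes "borel_prob (top_of_set Y) \<nu>"
  shows "Measurable.pred \<nu> (\<lambda>y. y i = b)"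
proof -
  have "openin (top_of_set Y) (Y \<inter> {y. y i \<in> {b}})"
    by (rule openin_open_Int[OF open_coordinate])
  then have "Y \<inter> {y. y i \<in> {b}} \<in> sets \<nu>"
    using assms sets_borel_of_openin by (auto simp: borel_prob_def)
  moreover have "{y \<in> space \<nu>. y i = b} = Y \<inter> {y. y i \<in> {b}}"
    using borel_prob_space[OF assms] by auto
  ultimately show ?thesis by (simp add: pred_def)
qed

lemma borel_prob_closed:
  assumes "borel_prob (top_of_set Y) \<nu>" "closed C" "C \<subseteq> Y"
  shows "C \<in> sets \<nu>"
proof -
  have "openin (top_of_set Y) (Y \<inter> - C)"
    by (rule openin_open_Int) (use assms(2) in \<open>simp add: open_Compl\<close>)
  then have "Y \<inter> - C \<in> sets \<nu>" using assms(1) sets_borel_of_openin by (auto simp: borel_prob_def)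
  then have "space \<nu> - (Y \<inter> - C) \<in> sets \<nu>" by blast
  moreover have "space \<nu> - (Y \<inter> - C) = C" using borel_prob_space[OF assms(1)] assms(3) by auto
  ultimately show ?thesis by simp
qed

lemma pred_occurs_at:
  fixes Y :: "(int \<Rightarrow> 'b::discrete_topology) set"
  assumes "borel_prob (top_of_set Y) \<nu>"
  shows "Measurable.pred \<nu> (\<lambda>y. occurs_at w y i)"
  using borel_prob_coordinate[OF assms] unfolding occurs_at_def by measurable

section \<open>Almost every point is doubly transitive\<close>

text \<open>
The set of points showing \<open>w\<close> somewhere beyond \<open>n\<close> decreases with \<open>n\<close>, and by invariance its measure is at
least that of the points showing \<open>w\<close> at the origin, which is positive by full support. So recurrence is
an invariant event of positive measure.
\<close>

lemma emeasure_recurs: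
  fixes Y :: "(int \<Rightarrow> 'b::{finite,discrete_topology}) set"
  assumes Y: "shift_space Y" and \<nu>: "borel_prob (top_of_set Y) \<nu>" "ergodic_measure shift_map \<nu>"
    and full: "fully_supported (top_of_set Y) \<nu>" and w: "w \<in> language Y" and \<epsilon>: "\<bar>\<epsilon>\<bar> = 1"
  shows "AE y in \<nu>. recurs \<epsilon> w y"
proof -
  interpret prob_space \<nu> using \<nu>(1) by (simp add: borel_prob_def)
  have sp: "space \<nu> = Y" using borel_prob_space[OF \<nu>(1)] by simp
  note [measurable] = pred_occurs_at[OF \<nu>(1)]
  have S: "shift_map \<in> measurable \<nu> \<nu>" "distr \<nu> \<nu> shift_map = \<nu>"
    using \<nu>(2) by (auto simp: ergodic_measure_def invariant_measure_def)
  define Q where "Q i = {y \<in> space \<nu>. occurs_at w y i}" for i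
  have Q_sets [measurable]: "Q i \<in> sets \<nu>" for i unfolding Q_def by measurable
  have Q_Suc: "emeasure \<nu> (Q (i + 1)) = emeasure \<nu> (Q i)" for i
  proof -
    have "emeasure \<nu> (Q i) = emeasure (distr \<nu> \<nu> shift_map) (Q i)" using S(2) by simp
    also have "\<dots> = emeasure \<nu> (shift_map -` Q i \<inter> space \<nu>)" by (rule emeasure_distr[OF S(1) Q_sets])
    also have "shift_map -` Q i \<inter> space \<nu> = Q (i + 1)"
      using measurable_space[OF S(1)] by (auto simp: Q_def occurs_at_shift_map)
    finally show ?thesis by simp
  qed
  have Q_const: "emeasure \<nu> (Q i) = emeasure \<nu> (Q 0)" for i
  proof (induction i rule: int_induct[where k = 0])
    case (step2 i) then show ?case using Q_Suc[of "i - 1"] by simp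
  qed (use Q_Suc in auto)
  have "emeasure \<nu> (Q 0) > 0"
  proof -
    obtain y where "y \<in> Y" "occurs_at w y 0" using language_occurs_at[OF Y w] by blast
    then have "Q 0 \<noteq> {}" using sp by (auto simp: Q_def)
    moreover have "openin (top_of_set Y) (Y \<inter> (\<Inter>k\<in>{..<length w}. {y. y (0 + int k) \<in> {w ! k}}))"
      by (intro openin_open_Int open_INT ballI open_coordinate) simp
    moreover have "Y \<inter> (\<Inter>k\<in>{..<length w}. {y. y (0 + int k) \<in> {w ! k}}) = Q 0"
      using sp by (auto simp: Q_def occurs_at_def)
    ultimately show ?thesis using full unfolding fully_supported_def by auto
  qed
  define B where "B n = (\<Union>i\<in>{i. int n \<le> \<epsilon> * i}. Q i)" for n :: nat
  have B_sets: "B n \<in> sets \<nu>" for n unfolding B_def by (intro sets.countable_UN'') auto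
  have "emeasure \<nu> (Q 0) \<le> emeasure \<nu> (B n)" for n
  proof -
    have "\<epsilon> * \<epsilon> = 1" using \<epsilon> by (metis abs_mult_self_eq mult_1)
    then have "int n \<le> \<epsilon> * (\<epsilon> * int n)" by (simp flip: mult.assoc)
    then have "emeasure \<nu> (Q (\<epsilon> * int n)) \<le> emeasure \<nu> (B n)"
      using B_sets by (intro emeasure_mono) (auto simp: B_def)
    then show ?thesis by (simp only: Q_const[of "\<epsilon> * int n"])
  qed
  then have "emeasure \<nu> (Q 0) \<le> (INF n. emeasure \<nu> (B n))" by (intro INF_greatest)
  also have "\<dots> = emeasure \<nu> (\<Inter>n. B n)"
  proof (rule INF_emeasure_decseq)
    show "range B \<subseteq> sets \<nu>" using B_sets by auto
    have "B (Suc n) \<subseteq> B n" for n unfolding B_def by (rule UN_mono) auto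
    then show "decseq B" by (rule decseq_SucI)
    show "emeasure \<nu> (B n) \<noteq> \<infinity>" for n by simp
  qed
  finally have pos: "emeasure \<nu> (\<Inter>n. B n) > 0" using \<open>emeasure \<nu> (Q 0) > 0\<close> by simp
  have B_eq: "(\<Inter>n. B n) = {y \<in> space \<nu>. recurs \<epsilon> w y}"
    unfolding B_def Q_def recurs_def by blast
  have R_sets: "{y \<in> space \<nu>. recurs \<epsilon> w y} \<in> sets \<nu>" 
    unfolding B_eq[symmetric] using B_sets by blast
  have "shift_map -` {y \<in> space \<nu>. recurs \<epsilon> w y} \<inter> space \<nu> = {y \<in> space \<nu>. recurs \<epsilon> w y}"
    using measurable_space[OF S(1)] recurs_shift_map[OF \<epsilon>, of w] by auto
  then have "emeasure \<nu> {y \<in> space \<nu>. recurs \<epsilon> w y} = 0 \<or> emeasure \<nu> {y \<in> space \<nu>. recurs \<epsilon> w y} = 1"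
    using \<nu>(2) R_sets unfolding ergodic_measure_def by blast
  then have "emeasure \<nu> {y \<in> space \<nu>. recurs \<epsilon> w y} = 1"
    using pos unfolding B_eq by auto
  then show ?thesis
    using AE_in_set_eq_1[OF R_sets] by (auto simp: measure_def)
qed

lemma emeasure_doubly_transitive:
  fixes Y :: "(int \<Rightarrow> 'b::{finite,discrete_topology}) set"
  assumes Y: "shift_space Y" and \<nu>: "borel_prob (top_of_set Y) \<nu>" "ergodic_measure shift_map \<nu>"
    and full: "fully_supported (top_of_set Y) \<nu>"
  shows "{y. doubly_transitive Y y} \<in> sets \<nu>" "emeasure \<nu> {y. doubly_transitive Y y} = 1"
proof -
  interpret prob_space \<nu> using \<nu>(1) by (simp add: borel_prob_def)
  have sp: "space \<nu> = Y" using borel_prob_space[OF \<nu>(1)] by simp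
  note [measurable] = pred_occurs_at[OF \<nu>(1)]
  have D: "{y. doubly_transitive Y y} =
      {y \<in> space \<nu>. \<forall>w\<in>language Y. recurs 1 w y \<and> recurs (- 1) w y}"
    using sp by (auto simp: doubly_transitive_iff_recurs)
  have count: "countable (language Y)" by simp
  have R: "Measurable.pred \<nu> (\<lambda>y. recurs \<epsilon> w y)" for \<epsilon> w unfolding recurs_def by measurable
  show "{y. doubly_transitive Y y} \<in> sets \<nu>" unfolding D
    by (intro predE pred_intros_countable_bounded(3) pred_intros_logic count R)
  have "AE y in \<nu>. \<forall>w\<in>language Y. recurs 1 w y \<and> recurs (- 1) w y"
    using emeasure_recurs[OF Y \<nu> full] by (subst AE_ball_countable[OF count]) auto
  then have "AE y in \<nu>. y \<in> {y. doubly_transitive Y y}" unfolding D by auto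
  then show "emeasure \<nu> {y. doubly_transitive Y y} = 1"
    using AE_in_set_eq_1[OF \<open>{y. doubly_transitive Y y} \<in> sets \<nu>\<close>] by (simp add: emeasure_eq_measure)
qed

section \<open>Measurable enumeration of fibres\<close>

definition window :: "nat \<Rightarrow> (int \<Rightarrow> 'a) \<Rightarrow> 'a list" where
  "window n x = map x [- int n..int n]"

lemma window_eq_iff: "window n x = window n x' \<longleftrightarrow> (\<forall>i. \<bar>i\<bar> \<le> int n \<longrightarrow> x i = x' i)"
  unfolding window_def by (auto simp: abs_le_iff)

lemma window_natD:
  assumes "window (nat N) x = window (nat N) x'" "\<bar>i\<bar> \<le> N" shows "x i = x' i"
proof -
  have "\<bar>i\<bar> \<le> int (nat N)" using assms(2) by linarith
  then show ?thesis using assms(1) unfolding window_eq_iff by blast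
qed

lemma closed_window: "closed {x :: int \<Rightarrow> 'a::discrete_topology. window n x = p}"
proof (rule closedI_limits)
  fix x :: "int \<Rightarrow> 'a" assume "\<And>N. \<exists>x'\<in>{x. window n x = p}. \<forall>i. \<bar>i\<bar> \<le> N \<longrightarrow> x' i = x i"
  then obtain x' where "window n x' = p" "\<forall>i. \<bar>i\<bar> \<le> int n \<longrightarrow> x' i = x i" by blast
  then show "x \<in> {x. window n x = p}" using window_eq_iff[of n x' x] by auto
qed

text \<open>
The set in question is the image of a compact set, hence closed.
\<close>

lemma pred_lift_in_closed:
  fixes X :: "(int \<Rightarrow> 'a::{finite,discrete_topology}) set"
    and Y :: "(int \<Rightarrow> 'b::{finite,discrete_topology}) set"
  assumes code: "factor_code \<pi> X Y" and \<nu>: "borel_prob (top_of_set Y) \<nu>" and C: "closed C"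
  shows "Measurable.pred \<nu> (\<lambda>y. \<exists>x\<in>fibre \<pi> X y. x \<in> C)"
proof -
  have X: "closed X" "continuous_on X \<pi>" "\<pi> ` X = Y"
    using code by (auto simp: factor_code_def shift_space_def)
  have "closed (\<pi> ` (X \<inter> C))"
    by (rule closed_continuous_image[OF closed_Int[OF X(1) C] continuous_on_subset[OF X(2)]]) auto
  then have "\<pi> ` (X \<inter> C) \<in> sets \<nu>" using X(3) by (intro borel_prob_closed[OF \<nu>]) auto
  moreover have "{y \<in> space \<nu>. \<exists>x\<in>fibre \<pi> X y. x \<in> C} = \<pi> ` (X \<inter> C)"
    using borel_prob_space[OF \<nu>] X(3) by (auto simp: fibre_def)
  ultimately show ?thesis by (simp add: pred_def)
qed

text \<open>
The \<open>d\<close> points of a fibre are told apart by their blocks on some \<open>[-n, n]\<close>. A pair of \<open>n\<close> and a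
list of \<open>d\<close> distinct blocks, all of them occurring in the fibre, numbers the points of the fibre.
There are countably many such pairs and each is valid on a Borel set, so the first valid one in a fixed
enumeration of all pairs depends on \<open>y\<close> in a Borel way.
\<close>

lemma measurable_enumeration_of_fibres:
  fixes X :: "(int \<Rightarrow> 'a::{finite,discrete_topology}) set"
    and Y :: "(int \<Rightarrow> 'b::{finite,discrete_topology}) set"
  assumes code: "factor_code \<pi> X Y" and \<nu>: "borel_prob (top_of_set Y) \<nu>" and "X \<noteq> {}"
    and D: "D \<in> sets \<nu>" "\<And>y. y \<in> D \<Longrightarrow> finite (fibre \<pi> X y) \<and> card (fibre \<pi> X y) = d"
  shows "\<exists>s. (\<forall>k<d. \<forall>y. s k y \<in> X) \<and> (\<forall>k<d. \<forall>i a. Measurable.pred \<nu> (\<lambda>y. s k y i = a)) \<and>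
     (\<forall>y\<in>D. bij_betw (\<lambda>k. s k y) {..<d} (fibre \<pi> X y))"
proof -
  obtain x0 where x0: "x0 \<in> X" using \<open>X \<noteq> {}\<close> by blast
  \<comment> \<open>Validity of the pair \<open>j\<close> at \<open>y\<close>, phrased by closed sets of lifts so that it is visibly a Borel condition.\<close>
  define P where "P j y \<longleftrightarrow> length (snd j) = d \<and> distinct (snd j) \<and>
      (\<forall>k<d. \<exists>x\<in>fibre \<pi> X y. x \<in> {x. window (fst j) x = snd j ! k})" for j :: "nat \<times> 'a list list" and y
  have P_meas [measurable]: "Measurable.pred \<nu> (P j)" for j
    unfolding P_def[abs_def] using pred_lift_in_closed[OF code \<nu> closed_window] by measurable
  have P_ex: "\<exists>j. P j y" if y: "y \<in> D" for y
  proof -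
    have fin: "finite (fibre \<pi> X y)" "card (fibre \<pi> X y) = d" using D(2)[OF y] by auto
    obtain T where T: "\<forall>u\<in>fibre \<pi> X y. \<forall>v\<in>fibre \<pi> X y. (\<forall>l. \<bar>l\<bar> \<le> T \<longrightarrow> u l = v l) \<longrightarrow> u = v"
      using finite_functions_separated[OF fin(1)] by blast
    have inj: "inj_on (window (nat T)) (fibre \<pi> X y)"
    proof (rule inj_onI)
      fix u v assume uv: "u \<in> fibre \<pi> X y" "v \<in> fibre \<pi> X y" "window (nat T) u = window (nat T) v"
      have "\<forall>l. \<bar>l\<bar> \<le> T \<longrightarrow> u l = v l" using window_natD[OF uv(3)] by simp
      then show "u = v" using T uv(1,2) by blast
    qed
    obtain xs where xs: "set xs = fibre \<pi> X y" "distinct xs"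
      using finite_distinct_list[OF fin(1)] by blast
    then have len: "length xs = d" using fin(2) distinct_card by fastforce
    have "P (nat T, map (window (nat T)) xs) y"
      unfolding P_def fst_conv snd_conv
    proof (intro conjI allI impI)
      show "length (map (window (nat T)) xs) = d" using len by simp
      show "distinct (map (window (nat T)) xs)" using inj xs by (simp add: distinct_map)
      fix k assume "k < d"
      then have "xs ! k \<in> fibre \<pi> X y" "window (nat T) (xs ! k) = map (window (nat T)) xs ! k"
        using xs(1) len by (auto simp flip: xs(1))
      then show "\<exists>x\<in>fibre \<pi> X y. x \<in> {x. window (nat T) x = map (window (nat T)) xs ! k}" by blast
    qed
    then show ?thesis ..
  qed
  have P_bij: "\<exists>f. bij_betw f {..<d} (fibre \<pi> X y) \<and>
      (\<forall>k<d. \<forall>x\<in>fibre \<pi> X y. window (fst j) x = snd j ! k \<longleftrightarrow> x = f k)" if y: "y \<in> D" and Pj: "P j y" for j y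
  proof -
    have fin: "finite (fibre \<pi> X y)" "card (fibre \<pi> X y) = d" using D(2)[OF y] by auto
    have len: "length (snd j) = d" "distinct (snd j)" using Pj by (auto simp: P_def)
    have "\<forall>k. \<exists>x. k < d \<longrightarrow> x \<in> fibre \<pi> X y \<and> window (fst j) x = snd j ! k"
      using Pj unfolding P_def by blast
    then obtain f where f: "\<And>k. k < d \<Longrightarrow> f k \<in> fibre \<pi> X y" "\<And>k. k < d \<Longrightarrow> window (fst j) (f k) = snd j ! k"
      by metis
    have inj: "inj_on f {..<d}"
      using f(2) len by (intro inj_onI) (metis lessThan_iff nth_eq_iff_index_eq)
    have "f ` {..<d} = fibre \<pi> X y"
      by (rule card_subset_eq) (use fin f(1) inj in \<open>auto simp: card_image\<close>)
    then have bij: "bij_betw f {..<d} (fibre \<pi> X y)" using inj by (simp add: bij_betw_def)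
    have "x = f k" if k: "k < d" and x: "x \<in> fibre \<pi> X y" "window (fst j) x = snd j ! k" for k x
    proof -
      obtain k' where k': "k' < d" "x = f k'" using bij x(1) by (auto simp: bij_betw_def)
      then have "snd j ! k' = snd j ! k" using f(2) x(2) by metis
      then have "k' = k" using k k'(1) len by (simp add: nth_eq_iff_index_eq)
      then show ?thesis using k'(2) by simp
    qed
    then show ?thesis using bij f(2) by blast
  qed
  define J where "J y = (LEAST m. P (from_nat m) y)" for y
  have J_meas [measurable]: "J \<in> measurable \<nu> (count_space UNIV)"
    unfolding J_def[abs_def] by measurable
  have J: "P (from_nat (J y)) y" if y: "y \<in> D" for y
  proof -
    obtain j where "P j y" using P_ex[OF y] by blast
    then have "P (from_nat (to_nat j)) y" by simp
    then show ?thesis unfolding J_def by (rule LeastI)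
  qed
  define R where "R m k y x \<longleftrightarrow> x \<in> fibre \<pi> X y \<and> window (fst (from_nat m :: nat \<times> 'a list list)) x = snd (from_nat m :: nat \<times> 'a list list) ! k"
    for m k y x
  \<comment> \<open>Off \<open>D\<close> a fixed point of \<open>X\<close> keeps the functions total with values in \<open>X\<close>.\<close>
  define s where "s k y = (if y \<in> D then SOME x. R (J y) k y x else x0)" for k y
  have s: "\<exists>f. bij_betw f {..<d} (fibre \<pi> X y) \<and> (\<forall>k<d. s k y = f k \<and> (\<forall>x. R (J y) k y x \<longleftrightarrow> x = f k))"
    if y: "y \<in> D" for y
  proof -
    obtain f where f: "bij_betw f {..<d} (fibre \<pi> X y)"
      "\<forall>k<d. \<forall>x\<in>fibre \<pi> X y. window (fst (from_nat (J y) :: nat \<times> 'a list list)) x = snd (from_nat (J y) :: nat \<times> 'a list list) ! k \<longleftrightarrow> x = f k"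
      using P_bij[OF y J[OF y]] by blast
    have Rf: "R (J y) k y x \<longleftrightarrow> x = f k" if k: "k < d" for k x
    proof -
      have "f k \<in> fibre \<pi> X y" using f(1) k by (auto simp: bij_betw_def)
      then show ?thesis using f(2) k unfolding R_def by blast
    qed
    have "s k y = f k" if k: "k < d" for k
    proof -
      have "(SOME x. R (J y) k y x) = f k" by (rule some_equality) (simp_all only: Rf[OF k])
      then show ?thesis using y by (simp only: s_def if_True)
    qed
    then show ?thesis using f(1) Rf by (intro exI[of _ f] conjI allI impI) assumption+
  qed
  have s_X: "s k y \<in> X" if k: "k < d" for k y
  proof (cases "y \<in> D")
    case True
    then obtain f where "bij_betw f {..<d} (fibre \<pi> X y)" "s k y = f k" using s k by blast
    then show ?thesis using k by (auto simp: bij_betw_def fibre_def)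
  qed (use x0 in \<open>simp add: s_def\<close>)
  have s_bij: "bij_betw (\<lambda>k. s k y) {..<d} (fibre \<pi> X y)" if y: "y \<in> D" for y
  proof -
    obtain f where f: "bij_betw f {..<d} (fibre \<pi> X y)" "\<forall>k<d. s k y = f k" using s[OF y] by blast
    then show ?thesis by (subst bij_betw_cong[of _ _ f]) auto
  qed
  have s_meas: "Measurable.pred \<nu> (\<lambda>y. s k y i = a)" if k: "k < d" for k i a
  proof -
    have "s k y i = a \<longleftrightarrow> (if y \<in> D then \<exists>m. J y = m \<and> (\<exists>x\<in>fibre \<pi> X y.
        x \<in> {x. window (fst (from_nat m :: nat \<times> 'a list list)) x = snd (from_nat m :: nat \<times> 'a list list) ! k} \<inter> {x. x i = a})
        else x0 i = a)" for y
    proof (cases "y \<in> D")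
      case True
      then obtain f where "s k y = f k" "\<forall>x. R (J y) k y x \<longleftrightarrow> x = f k" using s k by blast
      then have "s k y i = a \<longleftrightarrow> (\<exists>x. R (J y) k y x \<and> x i = a)" by simp
      then show ?thesis using True unfolding R_def by auto
    qed (simp add: s_def)
    then show ?thesis
      using D(1) pred_lift_in_closed[OF code \<nu> closed_Int[OF closed_window closed_coordinate]]
      by simp
  qed
  show ?thesis using s_X s_bij s_meas by blast
qed

section \<open>Powers of a shift space\<close>

lemma topspace_power_topology [simp]: "topspace (power_topology d X) = {..<d} \<rightarrow>\<^sub>E X"
  by (simp add: power_topology_def)

lemma continuous_map_power_coordinate:
  "k < d \<Longrightarrow> continuous_map (power_topology d X) (top_of_set X) (\<lambda>t. t k)"
  unfolding power_topology_def by (rule continuous_map_product_projection) simp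

lemma pred_power_coordinate:
  fixes X :: "(int \<Rightarrow> 'a::{finite,discrete_topology}) set"
  assumes k: "k < d"
  shows "Measurable.pred (borel_of (power_topology d X)) (\<lambda>t. t k i = a)"
proof -
  have "openin (top_of_set X) (X \<inter> {x. x i \<in> {a}})" by (rule openin_open_Int[OF open_coordinate])
  then have op: "openin (power_topology d X) {t \<in> topspace (power_topology d X). t k \<in> X \<inter> {x. x i \<in> {a}}}"
    by (rule openin_continuous_map_preimage[OF continuous_map_power_coordinate[OF k]])
  have eq: "{t \<in> topspace (power_topology d X). t k \<in> X \<inter> {x. x i \<in> {a}}} =
      {t \<in> space (borel_of (power_topology d X)). t k i = a}"
    using k by (auto simp: PiE_iff)
  show ?thesis unfolding pred_def eq[symmetric] by (rule sets_borel_of_openin[OF op])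
qed

lemma power_topology_cylinder:
  fixes X :: "(int \<Rightarrow> 'a::{finite,discrete_topology}) set"
  assumes U: "openin (power_topology d X) U" and t: "t \<in> U"
  shows "\<exists>n. \<forall>t'\<in>{..<d} \<rightarrow>\<^sub>E X. (\<forall>k<d. window n (t' k) = window n (t k)) \<longrightarrow> t' \<in> U"
proof -
  obtain W where W: "t \<in> PiE {..<d} W" "\<And>k. openin (top_of_set X) (W k)" "PiE {..<d} W \<subseteq> U"
    using product_topology_open_contains_basis[OF U[unfolded power_topology_def] t] by blast
  have "\<exists>N::nat. \<forall>x\<in>X. window N x = window N (t k) \<longrightarrow> x \<in> W k" if k: "k < d" for k
  proof -
    obtain W' where W': "open W'" "W k = X \<inter> W'" using W(2) by (auto simp: openin_open)
    have "t k \<in> W'" using W(1) W'(2) k by (auto simp: PiE_iff)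
    then obtain N where N: "\<forall>x'. (\<forall>i. \<bar>i\<bar> \<le> N \<longrightarrow> x' i = t k i) \<longrightarrow> x' \<in> W'"
      using open_contains_cylinder[OF W'(1)] by blast
    show ?thesis
    proof (intro exI ballI impI)
      fix x assume x: "x \<in> X" "window (nat N) x = window (nat N) (t k)"
      have "\<forall>i. \<bar>i\<bar> \<le> N \<longrightarrow> x i = t k i" using window_natD[OF x(2)] by simp
      then show "x \<in> W k" using N x(1) W'(2) by simp
    qed
  qed
  then obtain N where N: "\<And>k x. k < d \<Longrightarrow> x \<in> X \<Longrightarrow> window (N k) x = window (N k) (t k) \<Longrightarrow> x \<in> W k"
    by metis
  define n where "n = Max (insert 0 (N ` {..<d}))"
  have "t' \<in> U" if t': "t' \<in> {..<d} \<rightarrow>\<^sub>E X" "\<forall>k<d. window n (t' k) = window n (t k)" for t'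
  proof -
    have "t' k \<in> W k" if k: "k < d" for k
    proof -
      have "N k \<le> n" unfolding n_def using k by (intro Max_ge) auto
      then have "window (N k) (t' k) = window (N k) (t k)" using t'(2) k by (auto simp: window_eq_iff)
      then show ?thesis using N[OF k, of "t' k"] t'(1) k by auto
    qed
    then have "t' \<in> PiE {..<d} W" using t'(1) by (auto simp: PiE_iff)
    then show ?thesis using W(3) by blast
  qed
  then show ?thesis by blast
qed

text \<open>
The topology has a countable base of cylinders, so measurability of the individual symbols suffices.
\<close>

lemma measurable_power_coordinatewise:
  fixes X :: "(int \<Rightarrow> 'a::{finite,discrete_topology}) set"
  assumes G: "\<And>y. y \<in> space M \<Longrightarrow> G y \<in> {..<d} \<rightarrow>\<^sub>E X"
    and meas: "\<And>k i a. k < d \<Longrightarrow> Measurable.pred M (\<lambda>y. G y k i = a)"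
  shows "G \<in> measurable M (borel_of (power_topology d X))"
proof (subst borel_of_def, rule measurable_measure_of)
  show "{U. openin (power_topology d X) U} \<subseteq> Pow (topspace (power_topology d X))"
    using openin_subset by blast
  show "G \<in> space M \<rightarrow> topspace (power_topology d X)" using G by simp
  fix U assume "U \<in> {U. openin (power_topology d X) U}"
  then have U: "openin (power_topology d X) U" by simp
  define B where "B j = {t \<in> {..<d} \<rightarrow>\<^sub>E X. \<forall>k<d. window (fst j) (t k) = snd j ! k}" for j :: "nat \<times> 'a list list"
  have "U = (\<Union>j\<in>{j. B j \<subseteq> U}. B j)"
  proof (intro equalityI subsetI)
    fix t assume t: "t \<in> U"
    obtain n where n: "\<forall>t'\<in>{..<d} \<rightarrow>\<^sub>E X. (\<forall>k<d. window n (t' k) = window n (t k)) \<longrightarrow> t' \<in> U"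
      using power_topology_cylinder[OF U t] by blast
    let ?j = "(n, map (\<lambda>k. window n (t k)) [0..<d])"
    have "B ?j \<subseteq> U" using n by (auto simp: B_def)
    moreover have "t \<in> B ?j" using openin_subset[OF U] t by (auto simp: B_def)
    ultimately show "t \<in> (\<Union>j\<in>{j. B j \<subseteq> U}. B j)" by blast
  qed auto
  then have "G -` U \<inter> space M = (\<Union>j\<in>{j. B j \<subseteq> U}. G -` B j \<inter> space M)" by blast
  moreover have "G -` B j \<inter> space M \<in> sets M" for j
  proof -
    have win: "window n x = p \<longleftrightarrow> length p = length [- int n..int n] \<and> (\<forall>l<length p. x ([- int n..int n] ! l) = p ! l)"
      for n and x :: "int \<Rightarrow> 'a" and p
      unfolding window_def by (auto simp: list_eq_iff_nth_eq)
    have "Measurable.pred M (\<lambda>y. window (fst j) (G y k) = snd j ! k)" if "k \<in> {..<d}" for k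
    proof -
      have [measurable]: "Measurable.pred M (\<lambda>y. G y k i = a)" for i a using meas that by simp
      show ?thesis unfolding win by measurable
    qed
    then have "Measurable.pred M (\<lambda>y. \<forall>k\<in>{..<d}. window (fst j) (G y k) = snd j ! k)"
      by (rule pred_intros_finite(3)[OF finite_lessThan])
    moreover have "G -` B j \<inter> space M = {y \<in> space M. \<forall>k\<in>{..<d}. window (fst j) (G y k) = snd j ! k}"
      using G by (auto simp: B_def)
    ultimately show ?thesis by (simp add: pred_def)
  qed
  then have "(\<Union>j\<in>{j. B j \<subseteq> U}. G -` B j \<inter> space M) \<in> sets M"
    by (intro sets.countable_UN'') auto
  ultimately show "G -` U \<inter> space M \<in> sets M" by (simp only:)
qed

section \<open>Injective enumerations of a fibre\<close>

lemma enumerations_of_finite_set: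
  assumes A: "finite A" and e: "bij_betw e A F"
  shows "inj_on (\<lambda>\<sigma>. \<lambda>k\<in>A. e (\<sigma> k)) {\<sigma>. \<sigma> permutes A}"
    and "(\<lambda>\<sigma>. \<lambda>k\<in>A. e (\<sigma> k)) ` {\<sigma>. \<sigma> permutes A} = {t \<in> A \<rightarrow>\<^sub>E F. inj_on t A}"
proof -
  have inj: "inj_on e A" and im: "e ` A = F" using e by (auto simp: bij_betw_def)
  show "inj_on (\<lambda>\<sigma>. \<lambda>k\<in>A. e (\<sigma> k)) {\<sigma>. \<sigma> permutes A}"
  proof (rule inj_onI)
    fix \<sigma> \<tau> assume perm: "\<sigma> \<in> {\<sigma>. \<sigma> permutes A}" "\<tau> \<in> {\<sigma>. \<sigma> permutes A}"
      and eq: "(\<lambda>k\<in>A. e (\<sigma> k)) = (\<lambda>k\<in>A. e (\<tau> k))"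
    show "\<sigma> = \<tau>"
    proof
      fix k show "\<sigma> k = \<tau> k"
      proof (cases "k \<in> A")
        case True
        then have "e (\<sigma> k) = e (\<tau> k)" using fun_cong[OF eq, of k] by simp
        then show ?thesis using inj perm True by (auto simp: permutes_in_image dest: inj_onD)
      qed (use perm in \<open>auto simp: permutes_not_in\<close>)
    qed
  qed
  show "(\<lambda>\<sigma>. \<lambda>k\<in>A. e (\<sigma> k)) ` {\<sigma>. \<sigma> permutes A} = {t \<in> A \<rightarrow>\<^sub>E F. inj_on t A}"
  proof (intro equalityI subsetI)
    fix t assume "t \<in> (\<lambda>\<sigma>. \<lambda>k\<in>A. e (\<sigma> k)) ` {\<sigma>. \<sigma> permutes A}"
    then obtain \<sigma> where \<sigma>: "\<sigma> permutes A" "t = (\<lambda>k\<in>A. e (\<sigma> k))" by blast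
    have "inj_on (e \<circ> \<sigma>) A"
      using inj permutes_inj_on[OF \<sigma>(1)] permutes_image[OF \<sigma>(1)] by (simp add: comp_inj_on)
    then have "inj_on t A" unfolding \<sigma>(2) by (auto simp: inj_on_def)
    moreover have "t \<in> A \<rightarrow>\<^sub>E F" using \<sigma> im by (auto simp: permutes_in_image)
    ultimately show "t \<in> {t \<in> A \<rightarrow>\<^sub>E F. inj_on t A}" by simp
  next
    fix t assume "t \<in> {t \<in> A \<rightarrow>\<^sub>E F. inj_on t A}"
    then have t: "t \<in> A \<rightarrow>\<^sub>E F" "inj_on t A" by auto
    define \<sigma> where "\<sigma> k = (if k \<in> A then inv_into A e (t k) else k)" for k
    have in_A: "\<sigma> k \<in> A" "e (\<sigma> k) = t k" if "k \<in> A" for k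
    proof -
      have "t k \<in> e ` A" using t(1) that im by auto
      then show "\<sigma> k \<in> A" "e (\<sigma> k) = t k"
        using that by (simp_all add: \<sigma>_def inv_into_into f_inv_into_f)
    qed
    have "inj_on \<sigma> A" using t(2) in_A(2) by (metis inj_on_def)
    then have "bij_betw \<sigma> A A" using in_A(1) A by (simp add: bij_betw_def endo_inj_surj image_subsetI)
    then have "\<sigma> permutes A" by (rule bij_imp_permutes) (simp add: \<sigma>_def)
    moreover have "t = (\<lambda>k\<in>A. e (\<sigma> k))"
      using t(1) in_A(2) by (auto simp: fun_eq_iff PiE_iff extensional_def)
    ultimately show "t \<in> (\<lambda>\<sigma>. \<lambda>k\<in>A. e (\<sigma> k)) ` {\<sigma>. \<sigma> permutes A}" by blast
  qed
qed

lemma bij_betw_injective_tuples: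
  assumes f: "bij_betw f F F'"
  shows "bij_betw (\<lambda>t. \<lambda>i\<in>A. f (t i)) {t \<in> A \<rightarrow>\<^sub>E F. inj_on t A} {t \<in> A \<rightarrow>\<^sub>E F'. inj_on t A}"
proof -
  have map: "(\<lambda>i\<in>A. h (t i)) \<in> {t \<in> A \<rightarrow>\<^sub>E K. inj_on t A}"
    if h: "bij_betw h H K" and t: "t \<in> {t \<in> A \<rightarrow>\<^sub>E H. inj_on t A}" for h H K t
  proof -
    have "t i \<in> H" if "i \<in> A" for i using t that by auto
    then have "inj_on (\<lambda>i\<in>A. h (t i)) A" "\<And>i. i \<in> A \<Longrightarrow> h (t i) \<in> K"
      using t h by (auto simp: inj_on_def bij_betw_def)
    then show ?thesis by auto
  qed
  have g: "bij_betw (inv_into F f) F' F" using f by (rule bij_betw_inv_into)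
  show ?thesis
  proof (rule bij_betw_byWitness[where f' = "\<lambda>t. \<lambda>i\<in>A. inv_into F f (t i)"])
    show "\<forall>t\<in>{t \<in> A \<rightarrow>\<^sub>E F. inj_on t A}. (\<lambda>i\<in>A. inv_into F f ((\<lambda>i\<in>A. f (t i)) i)) = t"
      using bij_betw_inv_into_left[OF f] by (auto simp: fun_eq_iff PiE_iff extensional_def)
    show "\<forall>t\<in>{t \<in> A \<rightarrow>\<^sub>E F'. inj_on t A}. (\<lambda>i\<in>A. f ((\<lambda>i\<in>A. inv_into F f (t i)) i)) = t"
      using bij_betw_inv_into_right[OF f] by (auto simp: fun_eq_iff PiE_iff extensional_def)
  qed (use map[OF f] map[OF g] in blast)+
qed

lemma inj_shift_map: "inj shift_map"
proof (rule injI)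
  fix x y :: "int \<Rightarrow> 'a" assume "shift_map x = shift_map y"
  then have "x (i - 1 + 1) = y (i - 1 + 1)" for i unfolding shift_map_def by metis
  then show "x = y" by auto
qed

text \<open>
Surjectivity uses that the shift is invertible: a preimage of \<open>shift_map y\<close> is the shift of a point
of \<open>X\<close> whose image has the same shift as \<open>y\<close>.
\<close>

lemma bij_betw_shift_fibre:
  assumes code: "factor_code \<pi> X Y"
  shows "bij_betw shift_map (fibre \<pi> X y) (fibre \<pi> X (shift_map y))"
proof -
  have X: "shift_map ` X = X" and comm: "\<And>x. x \<in> X \<Longrightarrow> \<pi> (shift_map x) = shift_map (\<pi> x)"
    using code by (auto simp: factor_code_def shift_space_def)
  have "shift_map ` fibre \<pi> X y = fibre \<pi> X (shift_map y)"
  proof (intro equalityI subsetI)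
    fix x assume x: "x \<in> fibre \<pi> X (shift_map y)"
    then have "x \<in> shift_map ` X" using X by (simp add: fibre_def)
    then obtain x' where x': "x' \<in> X" "x = shift_map x'" by blast
    then have "shift_map (\<pi> x') = shift_map y" using x comm by (simp add: fibre_def)
    then have "\<pi> x' = y" by (rule injD[OF inj_shift_map])
    then have "x' \<in> fibre \<pi> X y" using x'(1) by (simp add: fibre_def)
    then show "x \<in> shift_map ` fibre \<pi> X y" unfolding x'(2) by (rule imageI)
  next
    fix x assume "x \<in> shift_map ` fibre \<pi> X y"
    then obtain x' where x': "x' \<in> X" "\<pi> x' = y" "x = shift_map x'" by (auto simp: fibre_def)
    then have "x \<in> X" using X by blast
    then show "x \<in> fibre \<pi> X (shift_map y)" using comm[OF x'(1)] x'(2,3) by (simp add: fibre_def)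
  qed
  then show ?thesis unfolding bij_betw_def using inj_on_subset[OF inj_shift_map] by blast
qed

section \<open>Existence of the joining\<close>

theorem theorem4p1:
  fixes X :: "(int \<Rightarrow> 'a::{finite,discrete_topology}) set"
    and Y :: "(int \<Rightarrow> 'b::{finite,discrete_topology}) set"
    and \<pi> :: "(int \<Rightarrow> 'a) \<Rightarrow> int \<Rightarrow> 'b"
    and \<nu> :: "(int \<Rightarrow> 'b) measure"
  assumes "irreducible_shift X" and "sofic_shift X"
    and "factor_code \<pi> X Y" and "finite_to_one \<pi> X Y"
    and "borel_prob (top_of_set Y) \<nu>" and "ergodic_measure shift_map \<nu>"
    and "fully_supported (top_of_set Y) \<nu>"
  shows "\<exists>\<Lambda>. relative_joining_over \<pi> X (code_degree \<pi> X Y) \<nu> \<Lambda> \<and>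
             ergodic_measure (diagonal_shift (code_degree \<pi> X Y)) \<Lambda> \<and>
             separating (code_degree \<pi> X Y) \<Lambda>"
proof -
  note code = assms(3) and \<nu> = assms(5)
  have Y: "shift_space Y" and im: "\<pi> ` X = Y" and cont: "continuous_on X \<pi>"
    using code by (auto simp: factor_code_def)
  interpret \<nu>: prob_space \<nu> using \<nu> by (simp add: borel_prob_def)
  have sp: "space \<nu> = Y" using borel_prob_space[OF \<nu>] by simp
  define D where "D = {y. doubly_transitive Y y}"
  have D: "D \<in> sets \<nu>" "emeasure \<nu> D = 1"
    unfolding D_def by (rule emeasure_doubly_transitive[OF Y assms(5-7)])+
  have DY: "D \<subseteq> Y" by (auto simp: D_def doubly_transitive_def)
  have D_shift: "shift_map y \<in> D \<longleftrightarrow> y \<in> D" if "y \<in> space \<nu>" for y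
    using doubly_transitive_shift_map[OF Y] that sp by (simp add: D_def)
  define d where "d = code_degree \<pi> X Y"
  obtain y0 where y0: "y0 \<in> D" using D(2) by fastforce
  have fibre_D: "finite (fibre \<pi> X y) \<and> card (fibre \<pi> X y) = d" if y: "y \<in> D" for y
  proof -
    obtain d' where d': "\<And>y. doubly_transitive Y y \<Longrightarrow> card (fibre \<pi> X y) = d'"
      using card_fibre_constant[OF assms(1-4)] by blast
    have fin: "finite (fibre \<pi> X y)" if "doubly_transitive Y y" for y
      using that assms(4) by (auto simp: finite_to_one_def doubly_transitive_def)
    have "code_degree \<pi> X Y = d'"
      unfolding code_degree_def
    proof (rule the_equality)
      show "\<forall>y. doubly_transitive Y y \<longrightarrow> finite (fibre \<pi> X y) \<and> card (fibre \<pi> X y) = d'"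
        using d' fin by blast
      fix c assume "\<forall>y. doubly_transitive Y y \<longrightarrow> finite (fibre \<pi> X y) \<and> card (fibre \<pi> X y) = c"
      then have "card (fibre \<pi> X y0) = c" using y0 by (simp add: D_def)
      then show "c = d'" using d'[of y0] y0 by (simp add: D_def)
    qed
    then show ?thesis using d'[of y] fin[of y] y by (simp add: d_def D_def)
  qed
  have "fibre \<pi> X y0 \<noteq> {}" using y0 DY im by (auto simp: fibre_def)
  then have d_pos: "0 < d" and X_ne: "X \<noteq> {}"
    using fibre_D[OF y0] by (auto simp: fibre_def card_gt_0_iff)
  obtain s where s_X: "\<And>k y. k < d \<Longrightarrow> s k y \<in> X"
    and s_meas: "\<And>k i a. k < d \<Longrightarrow> Measurable.pred \<nu> (\<lambda>y. s k y i = a)"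
    and s_bij: "\<And>y. y \<in> D \<Longrightarrow> bij_betw (\<lambda>k. s k y) {..<d} (fibre \<pi> X y)"
    using measurable_enumeration_of_fibres[OF code \<nu> X_ne D(1) fibre_D] by blast

  define N where "N = borel_of (power_topology d X)"
  have space_N: "space N = {..<d} \<rightarrow>\<^sub>E X" by (simp add: N_def)
  have N_coord: "Measurable.pred N (\<lambda>t. t k i = a)" if "k < d" for k i a
    unfolding N_def by (rule pred_power_coordinate[OF that])
  \<comment> \<open>The injective \<open>d\<close>-tuples over \<open>y\<close> are the rearrangements of the chosen enumeration of the fibre.\<close>
  define I where "I = {\<sigma>. \<sigma> permutes {..<d}}"
  define G where "G \<sigma> y = (\<lambda>k\<in>{..<d}. s (\<sigma> k) y)" for \<sigma> y
  have I: "finite I" "I \<noteq> {}"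
    using permutes_id by (auto simp: I_def finite_permutations intro!: exI[of _ id])
  have I_less: "\<sigma> k < d" if "\<sigma> \<in> I" "k < d" for \<sigma> k
    using that permutes_in_image[of \<sigma> "{..<d}" k] by (simp add: I_def)
  have G_meas: "G \<sigma> \<in> measurable \<nu> N" if "\<sigma> \<in> I" for \<sigma>
    unfolding N_def
    by (rule measurable_power_coordinatewise) (use that I_less s_X s_meas in \<open>auto simp: G_def\<close>)
  have T_meas: "diagonal_shift d \<in> measurable N N"
    unfolding N_def
  proof (rule measurable_power_coordinatewise)
    fix t assume "t \<in> space (borel_of (power_topology d X))"
    then have "t k \<in> X" if "k < d" for k using that by auto
    then show "diagonal_shift d t \<in> {..<d} \<rightarrow>\<^sub>E X"
      using code by (auto simp: diagonal_shift_def factor_code_def shift_space_def)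
  next
    fix k i a assume "k < d"
    then show "Measurable.pred (borel_of (power_topology d X)) (\<lambda>t. diagonal_shift d t k i = a)"
      using pred_power_coordinate[where k = k and d = d and X = X and i = "i + 1" and a = a] by (simp add: diagonal_shift_def shift_map_def)
  qed
  have orbit: "(\<lambda>\<sigma>. G \<sigma> y) ` I = {t \<in> {..<d} \<rightarrow>\<^sub>E fibre \<pi> X y. inj_on t {..<d}}"
    and G_inj: "inj_on (\<lambda>\<sigma>. G \<sigma> y) I" if "y \<in> D" for y
    using enumerations_of_finite_set[OF finite_lessThan s_bij[OF that]] by (simp_all add: G_def I_def)
  have T_bij: "bij_betw (diagonal_shift d) ((\<lambda>\<sigma>. G \<sigma> y) ` I) ((\<lambda>\<sigma>. G \<sigma> (shift_map y)) ` I)"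
    if y: "y \<in> D" for y
  proof -
    have "shift_map y \<in> D" using D_shift y DY sp by blast
    then show ?thesis
      unfolding orbit[OF y] orbit[OF \<open>shift_map y \<in> D\<close>] diagonal_shift_def[abs_def]
      by (intro bij_betw_injective_tuples bij_betw_shift_fibre[OF code])
  qed
  have G_orbit: "G \<sigma> y \<in> {..<d} \<rightarrow>\<^sub>E fibre \<pi> X y" "inj_on (G \<sigma> y) {..<d}"
    if "y \<in> D" "\<sigma> \<in> I" for y \<sigma>
    using orbit[OF that(1)] that(2) by auto

  obtain \<Lambda> where \<Lambda>: "prob_space \<Lambda>" "sets \<Lambda> = sets N" "ergodic_measure (diagonal_shift d) \<Lambda>"
    and \<Lambda>_full: "\<And>B. B \<in> sets N \<Longrightarrow> (\<And>y \<sigma>. y \<in> D \<Longrightarrow> \<sigma> \<in> I \<Longrightarrow> G \<sigma> y \<in> B) \<Longrightarrow> emeasure \<Lambda> B = 1"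
    and \<Lambda>_push: "\<And>q. q \<in> measurable N \<nu> \<Longrightarrow> (\<And>y \<sigma>. y \<in> D \<Longrightarrow> \<sigma> \<in> I \<Longrightarrow> q (G \<sigma> y) = y) \<Longrightarrow> distr \<Lambda> \<nu> q = \<nu>"
    using finite_extension_ergodic_component[where G = G and S = shift_map,
        OF \<nu>.prob_space_axioms assms(6) D D_shift I G_meas T_meas G_inj T_bij]
    by blast
  have q_meas: "(\<lambda>t. \<pi> (t k)) \<in> measurable N \<nu>" if k: "k < d" for k
  proof -
    have "continuous_map (top_of_set X) (top_of_set Y) \<pi>"
      using cont im by (auto simp: continuous_map_in_subtopology)
    from continuous_map_compose[OF continuous_map_power_coordinate[OF k] this]
    have "(\<lambda>t. \<pi> (t k)) \<in> measurable N (borel_of (top_of_set Y))"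
      unfolding N_def by (intro measurable_borel_of_continuous) (simp add: comp_def)
    moreover have "measurable N \<nu> = measurable N (borel_of (top_of_set Y))"
      using \<nu> by (intro measurable_cong_sets refl) (simp add: borel_prob_def)
    ultimately show ?thesis by (simp only:)
  qed
  have push: "distr \<Lambda> \<nu> (\<lambda>t. \<pi> (t 0)) = \<nu>"
  proof (rule \<Lambda>_push[OF q_meas[OF d_pos]])
    fix y \<sigma> assume "y \<in> D" "\<sigma> \<in> I"
    then have "G \<sigma> y 0 \<in> fibre \<pi> X y" using G_orbit(1) d_pos by blast
    then show "\<pi> (G \<sigma> y 0) = y" by (simp add: fibre_def)
  qed

  define B where "B = {t \<in> space N. inj_on t {..<d} \<and> (\<forall>i\<in>{..<d}. \<forall>j\<in>{..<d}. \<pi> (t i) = \<pi> (t j))}"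
  have "B \<in> sets N"
  proof -
    have sep: "Measurable.pred N (\<lambda>t. t i = t j \<longrightarrow> i = j)" if ij: "i < d" "j < d" for i j
    proof -
      have [measurable]: "Measurable.pred N (\<lambda>t. t i k = a)" "Measurable.pred N (\<lambda>t. t j k = a)" for k a
        using N_coord ij by auto
      have "t i = t j \<longleftrightarrow> (\<forall>k a. t i k = a \<longleftrightarrow> t j k = a)" for t :: "nat \<Rightarrow> int \<Rightarrow> 'a"
        by (auto simp: fun_eq_iff)
      then show ?thesis by simp
    qed
    have eq: "Measurable.pred N (\<lambda>t. \<pi> (t i) = \<pi> (t j))" if ij: "i < d" "j < d" for i j
    proof -
      have [measurable]: "Measurable.pred N (\<lambda>t. \<pi> (t i) k = b)" "Measurable.pred N (\<lambda>t. \<pi> (t j) k = b)" for k b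
        using measurable_compose[OF q_meas borel_prob_coordinate[OF \<nu>]] ij by auto
      have "\<pi> (t i) = \<pi> (t j) \<longleftrightarrow> (\<forall>k b. \<pi> (t i) k = b \<longleftrightarrow> \<pi> (t j) k = b)" for t
        by (auto simp: fun_eq_iff)
      then show ?thesis by simp
    qed
    have "Measurable.pred N (\<lambda>t. \<forall>i\<in>{..<d}. \<forall>j\<in>{..<d}. (t i = t j \<longrightarrow> i = j) \<and> \<pi> (t i) = \<pi> (t j))"
      by (intro pred_intros_finite(3) finite_lessThan pred_intros_logic(3) sep eq) auto
    moreover have "B = {t \<in> space N. \<forall>i\<in>{..<d}. \<forall>j\<in>{..<d}. (t i = t j \<longrightarrow> i = j) \<and> \<pi> (t i) = \<pi> (t j)}"
      unfolding B_def inj_on_def by blast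
    ultimately show ?thesis by (simp add: pred_def)
  qed
  moreover have "G \<sigma> y \<in> B" if y: "y \<in> D" "\<sigma> \<in> I" for y \<sigma>
  proof -
    have "G \<sigma> y i \<in> fibre \<pi> X y" if "i < d" for i using G_orbit(1)[OF y] that by auto
    then have "\<pi> (G \<sigma> y i) = y" if "i < d" for i using that by (simp add: fibre_def)
    moreover have "G \<sigma> y \<in> space N"
      using measurable_space[OF G_meas[OF y(2)]] y(1) DY sp by blast
    ultimately show ?thesis using G_orbit(2)[OF y] by (simp add: B_def)
  qed
  ultimately have "emeasure \<Lambda> B = 1" by (rule \<Lambda>_full)
  then have AE_B: "AE t in \<Lambda>. t \<in> B"
    using prob_space.AE_in_set_eq_1[OF \<Lambda>(1), of B] \<open>B \<in> sets N\<close> \<Lambda>(2) by (simp add: measure_def)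
  have B_sub: "B \<subseteq> relative_power \<pi> X d"
    unfolding B_def relative_power_def space_N by blast
  have "AE t in \<Lambda>. t \<in> relative_power \<pi> X d"
    by (rule eventually_mono[OF AE_B]) (rule subsetD[OF B_sub])
  then have "relative_joining \<pi> X d \<Lambda>"
    using \<Lambda> unfolding relative_joining_def borel_prob_def N_def ergodic_measure_def by blast
  then have "relative_joining_over \<pi> X d \<nu> \<Lambda>"
    using push d_pos unfolding relative_joining_over_def by blast
  moreover have "separating d \<Lambda>"
    unfolding separating_def by (rule eventually_mono[OF AE_B]) (unfold B_def, blast)
  ultimately show ?thesis using \<Lambda>(3) unfolding d_def by blast
qed

end
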